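(* Let $\triangle^\ell_{\mathrm{PS}}$ be a Powell--Sabin refinement of $\triangle^\ell$, let $B_1,\dots,B_m$ be the vertex functions and $B^2_\eta$, $\eta\in\Xi_2$, the twice reduced functions over $\triangle^\ell_{\mathrm{PS}}$ defined in the context, and let $\mathbb S_2(\triangle^\ell_{\mathrm{PS}})$ be their linear span. Then the functions $B_1,\dots,B_m$ together with the functions $B^2_\eta$, $\eta\in\Xi_2$, form a convex partition of unity (they are nonnegative on $\Omega$ and sum to $1$) and a locally supported basis of $\mathbb S_2(\triangle^\ell_{\mathrm{PS}})$.
   Context: **Triangulation and split.** $\triangle$ is a (conforming) triangulation of a bounded planar polygonal domain $\Omega$. For $\ell\in\mathbb N$, $\ell\ge1$, $\triangle^\ell$ is the refinement of $\triangle$ obtained by splitting each triangle of $\triangle$ uniformly into $\ell^2$ congruent triangles so that each edge of $\triangle$ is split into $\ell$ equal intervals. $V^\ell,E^\ell,T^\ell$ are the sets of vertices $v_i$, edges $e_j$, triangles $t_k$ of $\triangle^\ell$. In each $t_k\in T^\ell$ a split point $v_k^t$ is chosen in the interior of $t_k$ such that for any two triangles $t_k,t_{k'}$ sharing an edge $e_j$ the segment $[v_k^t,v_{k'}^t]$ meets the interior of $e_j$; the intersection point is called $v_j^e$. If $e_j$ is a boundary edge, $v_j^e$ is its midpoint. The Powell--Sabin refinement $\triangle^\ell_{\mathrm{PS}}$ is obtained by connecting each $v_k^t$ to the three vertices of $t_k$ and to the three split points on the edges of $t_k$ (six small triangles per $t_k$, each of the form $\langle v_i,v_j^e,v_k^t\rangle$).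 **Symmetric triangles.** A triangle $t_k\in T^\ell$ with vertices $v_{i_1},v_{i_2},v_{i_3}$ has symmetric configuration if it has three neighbours in $\triangle^\ell$, these have vertices $\{v_{i_1},v_{i_2},v_{i_1}+v_{i_2}-v_{i_3}\}$, $\{v_{i_2},v_{i_3},v_{i_2}+v_{i_3}-v_{i_1}\}$, $\{v_{i_3},v_{i_1},v_{i_3}+v_{i_1}-v_{i_2}\}$, and the split points of $t_k$ and of its three neighbours are their barycenters. $T^\ell_{\mathrm{sym}}$ is the set of such triangles. **Cubic Powell--Sabin B-splines.** For each $v_i\in V^\ell$ a nondegenerate triangle $q_i^v$ is chosen that contains $v_i$ and all points $\frac23v_i+\frac13v_j^e$, $\frac23v_i+\frac13v_k^t$ for the edges $e_j$ and triangles $t_k$ of $\triangle^\ell$ attached to $v_i$. $\Xi_0$ is the set of triplets $(v_i,e_j,\tau)$, where $e_j\in E^\ell$, $v_i$ is an endpoint of $e_j$, and $\tau$ is a triangle of $T^\ell$ attached to $e_j$, or $\tau=\emptyset$ if $e_j$ is a boundary edge (so each edge gives four triplets). Given real coefficients $c_{i,r}$ ($v_i\in V^\ell$, $r=1,2,3$) and $c_\xi$ ($\xi\in\Xi_0$), define a continuous piecewise cubic $s$ on $\triangle^\ell_{\mathrm{PS}}$ through its Bernstein--Bézier ordinates on the small triangles; write $b(p_1,p_2,p_3)$ (symmetric in its arguments) for the ordinate at domain point $(p_1+p_2+p_3)/3$, where $p_1,p_2,p_3$ are (possibly repeated) vertices of a small triangle. - Let $L_i$ be the affine function taking value $c_{i,r}$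 at the $r$-th vertex of $q_i^v$. Then $b(v_i,v_i,w)=L_i(\frac23v_i+\frac13w)$ for $w=v_i$, $w=v_j^e$, $w=v_k^t$, with $e_j,t_k$ attached to $v_i$. - For $e_j$ with endpoints $v_i,v_{i'}$ write $v_j^e=\lambda v_i+\lambda'v_{i'}$, $\lambda+\lambda'=1$. For $t_k$ attached to $e_j$: $b(v_i,v_j^e,v_k^t)=\lambda\, b(v_i,v_i,v_k^t)+\lambda' c_{(v_i,e_j,t_k)}$, and analogously $b(v_{i'},v_j^e,v_k^t)=\lambda' b(v_{i'},v_{i'},v_k^t)+\lambda c_{(v_{i'},e_j,t_k)}$. - If $e_j$ is shared by $t_k,t_{k'}$ and $v_j^e=\mu v_k^t+\mu'v_{k'}^t$, $\mu+\mu'=1$, then $b(v_i,v_j^e,v_j^e)=\mu\, b(v_i,v_j^e,v_k^t)+\mu' b(v_i,v_j^e,v_{k'}^t)$ (same for $v_{i'}$). If $e_j$ is a boundary edge, then $b(v_i,v_j^e,v_j^e)=\lambda\, b(v_i,v_i,v_j^e)+\lambda' c_{(v_i,e_j,\emptyset)}$ and $b(v_{i'},v_j^e,v_j^e)=\lambda' b(v_{i'},v_{i'},v_j^e)+\lambda c_{(v_{i'},e_j,\emptyset)}$. - $b(v_j^e,v_j^e,w)=\lambda\, b(v_i,v_j^e,w)+\lambda' b(v_{i'},v_j^e,w)$ for $w\in\{v_j^e,v_k^t\}$. - If $t_k$ has vertices $v_{i_1},v_{i_2},v_{i_3}$ and $v_k^t=a_1v_{i_1}+a_2v_{i_2}+a_3v_{i_3}$,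 $a_1+a_2+a_3=1$, then $b(v_{i_1},v_k^t,v_k^t)=a_1b(v_{i_1},v_{i_1},v_k^t)+a_2c_{(v_{i_1},e_{12},t_k)}+a_3c_{(v_{i_1},e_{13},t_k)}$, where $e_{12},e_{13}$ are the edges $[v_{i_1},v_{i_2}]$, $[v_{i_1},v_{i_3}]$ (and analogously for $v_{i_2},v_{i_3}$); $b(v_j^e,v_k^t,v_k^t)=\lambda\, b(v_i,v_k^t,v_k^t)+\lambda' b(v_{i'},v_k^t,v_k^t)$; $b(v_k^t,v_k^t,v_k^t)=\sum_{n=1}^3a_n b(v_{i_n},v_k^t,v_k^t)$. The function $s$ with $c_{i,r}=1$ and all other coefficients $0$ is a vertex function; these are listed as $B_1,\dots,B_m$, $m=3|V^\ell|$. The function $s$ with $c_\xi=1$ and all other coefficients $0$ is denoted $B^0_\xi$, $\xi\in\Xi_0$. **First reduction.** $\Xi_1$ is the set of pairs $(e_j,\tau)$ with $e_j\in E^\ell$ and $\tau\in T^\ell$ attached to $e_j$, or $\tau=\emptyset$ if $e_j$ is a boundary edge. For an edge $e_j$ with endpoints $v_i,v_{i'}$ put $B^1_{(e_j,\tau)}=B^0_{(v_i,e_j,\tau)}+B^0_{(v_{i'},e_j,\tau)}$. **Second reduction.** $\Xi_2$ is the union of the set of pairs $(\emptyset,t_k)$, $t_k\in T^\ell_{\mathrm{sym}}$, and the set of pairs $(e_j,\tau)\in\Xi_1$ with $\tau\notin T^\ell_{\mathrm{sym}}$ ($\tau=\emptyset$ allowed). Put: - for $t_k\in T^\ell_{\mathrm{sym}}$: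 $B^2_{(\emptyset,t_k)}=\sum_{e_j}\big(\frac23B^1_{(e_j,t_k)}+\frac13B^1_{(e_j,t_{k'})}\big)$, the sum over the three edges $e_j$ of $t_k$, where $t_{k'}$ is the other triangle attached to $e_j$; - for $(e_j,\tau)\in\Xi_2$ such that the other triangle $t_k$ attached to $e_j$ is in $T^\ell_{\mathrm{sym}}$: $B^2_{(e_j,\tau)}=\frac23B^1_{(e_j,\tau)}+\frac13B^1_{(e_j,t_k)}$; - for all other $(e_j,\tau)\in\Xi_2$: $B^2_{(e_j,\tau)}=B^1_{(e_j,\tau)}$. **Local support** means: a vertex function associated with $v_i$ vanishes outside the triangles of $\triangle^\ell$ attached to $v_i$; $B^2_{(e_j,\tau)}$ vanishes outside the triangles of $\triangle^\ell$ attached to $e_j$; $B^2_{(\emptyset,t_k)}$ vanishes outside $t_k$ and its three neighbouring triangles in $\triangle^\ell$. *)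

theory Defs
  imports "HOL-Analysis.Analysis" "HOL-Library.Function_Algebras"
begin

type_synonym point = "real^2"

global_interpretation real_fun: vector_space "\<lambda>(a::real) (f::point \<Rightarrow> real) x. a * f x"
  by unfold_locales (auto simp: fun_eq_iff algebra_simps)

definition barycenter :: "point set \<Rightarrow> point" where
  "barycenter S = (\<Sum>v\<in>S. v) /\<^sub>R real (card S)"

text \<open>Barycentric coordinate of \<open>p\<close> at the vertex \<open>v\<close> of the simplex spanned by \<open>S\<close>;
  well defined for affinely independent \<open>S\<close> and \<open>p\<close> in its affine hull.\<close>

definition bary :: "point set \<Rightarrow> point \<Rightarrow> point \<Rightarrow> real" where
  "bary S p = (THE u. (\<Sum>v\<in>S. u v) = 1 \<and> (\<Sum>v\<in>S. u v *\<^sub>R v) = p \<and> (\<forall>v. v \<notin> S \<longrightarrow> u v = 0))"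

definition polygonal_domain :: "point set \<Rightarrow> bool" where
  "polygonal_domain \<Omega> \<longleftrightarrow> open \<Omega> \<and> connected \<Omega> \<and> \<Omega> \<noteq> {} \<and> bounded \<Omega> \<and>
     (\<exists>P. finite P \<and> (\<forall>p\<in>P. polytope p) \<and> closure \<Omega> = \<Union>P)"

text \<open>Triangles and edges are represented by their sets of vertices throughout.\<close>

definition triangulates :: "point set set \<Rightarrow> point set \<Rightarrow> bool" where
  "triangulates \<D> \<Omega> \<longleftrightarrow>
     (\<forall>t\<in>\<D>. card t = 3 \<and> \<not> affine_dependent t) \<and>
     triangulation ((\<lambda>t. convex hull t) ` \<D>) \<and>
     (\<Union>t\<in>\<D>. convex hull t) = closure \<Omega>"

definition lattice_point :: "nat \<Rightarrow> point \<Rightarrow> point \<Rightarrow> point \<Rightarrow> nat \<Rightarrow> nat \<Rightarrow> point" where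
  "lattice_point l a b c i j = a + (real i / real l) *\<^sub>R (b - a) + (real j / real l) *\<^sub>R (c - a)"

text \<open>The triangles with \<open>i + j < l\<close> are translates of \<open>{a, b, c}\<close> scaled by \<open>1 / l\<close>, those with
  \<open>i + j + 1 < l\<close> are the reflected ones between them; together there are \<open>l\<^sup>2\<close>. The labelling of the
  vertices of a triangle by \<open>a, b, c\<close> is immaterial.\<close>

definition refine :: "nat \<Rightarrow> point set set \<Rightarrow> point set set" where
  "refine l \<D> =
     {{lattice_point l a b c i j, lattice_point l a b c (i+1) j, lattice_point l a b c i (j+1)}
        | a b c i j. {a, b, c} \<in> \<D> \<and> i + j < l} \<union>
     {{lattice_point l a b c (i+1) j, lattice_point l a b c i (j+1), lattice_point l a b c (i+1) (j+1)}
        | a b c i j. {a, b, c} \<in> \<D> \<and> i + j + 1 < l}"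

text \<open>\<open>T\<close>: the triangles; \<open>vt t\<close> and \<open>ve e\<close>: the split points of the triangle \<open>t\<close> and of the
  edge \<open>e\<close>; \<open>q v r\<close> for \<open>r = 1, 2, 3\<close>: the vertices of the triangle chosen at \<open>v\<close>. The conditions
  on these data are given by the predicates \<open>splits\<close> and \<open>admissible\<close> below.\<close>

locale powell_sabin =
  fixes T :: "point set set"
    and vt :: "point set \<Rightarrow> point"
    and ve :: "point set \<Rightarrow> point"
    and q :: "point \<Rightarrow> nat \<Rightarrow> point"
begin

definition V :: "point set" where
  "V = \<Union>T"

definition edges_of :: "point set \<Rightarrow> point set set" where
  "edges_of t = {e. e \<subseteq> t \<and> card e = 2}"

definition E :: "point set set" where
  "E = (\<Union>t\<in>T. edges_of t)"

definition attached :: "point set \<Rightarrow> point set set" where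
  "attached e = {t \<in> T. e \<subseteq> t}"

definition boundary_edge :: "point set \<Rightarrow> bool" where
  "boundary_edge e \<longleftrightarrow> e \<in> E \<and> card (attached e) = 1"

definition other :: "point set \<Rightarrow> point set \<Rightarrow> point set" where
  "other e t = (THE t'. t' \<in> attached e \<and> t' \<noteq> t)"

definition neighbours :: "point set \<Rightarrow> point set set" where
  "neighbours t = {t' \<in> T. card (t \<inter> t') = 2}"

definition splits :: bool where
  "splits \<longleftrightarrow>
     (\<forall>t\<in>T. vt t \<in> interior (convex hull t)) \<and>
     (\<forall>e\<in>E. \<forall>t\<in>attached e. \<forall>t'\<in>attached e. t \<noteq> t' \<longrightarrow>
        ve e \<in> closed_segment (vt t) (vt t') \<inter> rel_interior (convex hull e)) \<and>
     (\<forall>e\<in>E. boundary_edge e \<longrightarrow> ve e = barycenter e)"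

definition sym_triangle :: "point set \<Rightarrow> bool" where
  "sym_triangle t \<longleftrightarrow>
     (\<exists>v1 v2 v3. t = {v1, v2, v3} \<and>
        neighbours t = {{v1, v2, v1 + v2 - v3}, {v2, v3, v2 + v3 - v1}, {v3, v1, v3 + v1 - v2}}) \<and>
     (\<forall>t'\<in>insert t (neighbours t). vt t' = barycenter t')"

definition T_sym :: "point set set" where
  "T_sym = {t \<in> T. sym_triangle t}"

definition Q :: "point \<Rightarrow> point set" where
  "Q v = {q v 1, q v 2, q v 3}"

definition admissible :: bool where
  "admissible \<longleftrightarrow> (\<forall>v\<in>V. \<not> collinear (Q v) \<and> v \<in> convex hull (Q v) \<and>
     (\<forall>e\<in>E. v \<in> e \<longrightarrow> (2/3) *\<^sub>R v + (1/3) *\<^sub>R ve e \<in> convex hull (Q v)) \<and>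
     (\<forall>t\<in>T. v \<in> t \<longrightarrow> (2/3) *\<^sub>R v + (1/3) *\<^sub>R vt t \<in> convex hull (Q v)))"

text \<open>The ordinates, named by the vertices of the domain point: \<open>v\<close>, \<open>e\<close>, \<open>t\<close> stand for a vertex
  and for the split points of an edge and of a triangle. The coefficients are
  \<open>cv v r\<close> and \<open>c (v, e, \<tau>)\<close>, where \<open>\<tau> = {}\<close> encodes the absent triangle at a boundary edge.
  For an endpoint \<open>v\<close> of \<open>e\<close>, the weight of \<open>ve e\<close> at the other endpoint is \<open>1 - lam v e\<close>.\<close>

definition lam :: "point \<Rightarrow> point set \<Rightarrow> real" where
  "lam v e = bary e (ve e) v"

definition b_vv :: "(point \<Rightarrow> nat \<Rightarrow> real) \<Rightarrow> point \<Rightarrow> point \<Rightarrow> real" where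
  "b_vv cv v w = (\<Sum>r=1..3. bary (Q v) ((2/3) *\<^sub>R v + (1/3) *\<^sub>R w) (q v r) * cv v r)"

definition b_vet :: "(point \<Rightarrow> nat \<Rightarrow> real) \<Rightarrow> (point \<times> point set \<times> point set \<Rightarrow> real) \<Rightarrow>
    point \<Rightarrow> point set \<Rightarrow> point set \<Rightarrow> real" where
  "b_vet cv c v e t = lam v e * b_vv cv v (vt t) + (1 - lam v e) * c (v, e, t)"

definition b_vee :: "(point \<Rightarrow> nat \<Rightarrow> real) \<Rightarrow> (point \<times> point set \<times> point set \<Rightarrow> real) \<Rightarrow>
    point \<Rightarrow> point set \<Rightarrow> real" where
  "b_vee cv c v e =
     (if boundary_edge e then lam v e * b_vv cv v (ve e) + (1 - lam v e) * c (v, e, {})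
      else \<Sum>t\<in>attached e. bary (vt ` attached e) (ve e) (vt t) * b_vet cv c v e t)"

definition b_eee :: "(point \<Rightarrow> nat \<Rightarrow> real) \<Rightarrow> (point \<times> point set \<times> point set \<Rightarrow> real) \<Rightarrow>
    point set \<Rightarrow> real" where
  "b_eee cv c e = (\<Sum>v\<in>e. lam v e * b_vee cv c v e)"

definition b_eet :: "(point \<Rightarrow> nat \<Rightarrow> real) \<Rightarrow> (point \<times> point set \<times> point set \<Rightarrow> real) \<Rightarrow>
    point set \<Rightarrow> point set \<Rightarrow> real" where
  "b_eet cv c e t = (\<Sum>v\<in>e. lam v e * b_vet cv c v e t)"

definition b_vtt :: "(point \<Rightarrow> nat \<Rightarrow> real) \<Rightarrow> (point \<times> point set \<times> point set \<Rightarrow> real) \<Rightarrow>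
    point \<Rightarrow> point set \<Rightarrow> real" where
  "b_vtt cv c v t = bary t (vt t) v * b_vv cv v (vt t) +
     (\<Sum>w\<in>t - {v}. bary t (vt t) w * c (v, {v, w}, t))"

definition b_ett :: "(point \<Rightarrow> nat \<Rightarrow> real) \<Rightarrow> (point \<times> point set \<times> point set \<Rightarrow> real) \<Rightarrow>
    point set \<Rightarrow> point set \<Rightarrow> real" where
  "b_ett cv c e t = (\<Sum>v\<in>e. lam v e * b_vtt cv c v t)"

definition b_ttt :: "(point \<Rightarrow> nat \<Rightarrow> real) \<Rightarrow> (point \<times> point set \<times> point set \<Rightarrow> real) \<Rightarrow>
    point set \<Rightarrow> real" where
  "b_ttt cv c t = (\<Sum>v\<in>t. bary t (vt t) v * b_vtt cv c v t)"

text \<open>The small triangle \<open>(v, e, t)\<close> of the Powell--Sabin refinement has the vertices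
  \<open>v\<close>, \<open>ve e\<close>, \<open>vt t\<close>.\<close>

definition small :: "(point \<times> point set \<times> point set) set" where
  "small = {(v, e, t). t \<in> T \<and> e \<in> edges_of t \<and> v \<in> e}"

fun corners :: "point \<times> point set \<times> point set \<Rightarrow> point set" where
  "corners (v, e, t) = {v, ve e, vt t}"

text \<open>Cubic Bernstein--Bezier form on a small triangle.\<close>

fun bb_form :: "(point \<Rightarrow> nat \<Rightarrow> real) \<Rightarrow> (point \<times> point set \<times> point set \<Rightarrow> real) \<Rightarrow>
    point \<times> point set \<times> point set \<Rightarrow> point \<Rightarrow> real" where
  "bb_form cv c (v, e, t) x =
     (let u1 = bary (corners (v, e, t)) x v;
          u2 = bary (corners (v, e, t)) x (ve e);
          u3 = bary (corners (v, e, t)) x (vt t)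
      in u1^3 * b_vv cv v v + 3 * u1^2 * u2 * b_vv cv v (ve e) + 3 * u1^2 * u3 * b_vv cv v (vt t)
       + 3 * u1 * u2^2 * b_vee cv c v e + 6 * u1 * u2 * u3 * b_vet cv c v e t
       + 3 * u1 * u3^2 * b_vtt cv c v t
       + u2^3 * b_eee cv c e + 3 * u2^2 * u3 * b_eet cv c e t + 3 * u2 * u3^2 * b_ett cv c e t
       + u3^3 * b_ttt cv c t)"

text \<open>The description is single-valued because the forms agree on common points of small triangles.
  Outside the triangulated region the function is set to 0, so that equality of such functions means
  equality on the region.\<close>

definition spline :: "(point \<Rightarrow> nat \<Rightarrow> real) \<Rightarrow> (point \<times> point set \<times> point set \<Rightarrow> real) \<Rightarrow>
    point \<Rightarrow> real" where
  "spline cv c x =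
     (if \<exists>\<sigma>\<in>small. x \<in> convex hull (corners \<sigma>)
      then THE y. \<exists>\<sigma>\<in>small. x \<in> convex hull (corners \<sigma>) \<and> y = bb_form cv c \<sigma> x
      else 0)"

definition vertex_fun :: "point \<times> nat \<Rightarrow> point \<Rightarrow> real" where
  "vertex_fun i = spline (\<lambda>v r. if (v, r) = i then 1 else 0) (\<lambda>_. 0)"

definition B0 :: "point \<times> point set \<times> point set \<Rightarrow> point \<Rightarrow> real" where
  "B0 \<xi> = spline (\<lambda>_ _. 0) (\<lambda>\<xi>'. if \<xi>' = \<xi> then 1 else 0)"

definition \<Xi>1 :: "(point set \<times> point set) set" where
  "\<Xi>1 = {(e, \<tau>). e \<in> E \<and> (\<tau> \<in> attached e \<or> \<tau> = {} \<and> boundary_edge e)}"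

definition B1 :: "point set \<Rightarrow> point set \<Rightarrow> point \<Rightarrow> real" where
  "B1 e \<tau> x = (\<Sum>v\<in>e. B0 (v, e, \<tau>) x)"

definition \<Xi>2 :: "(point set \<times> point set) set" where
  "\<Xi>2 = {({}, t) | t. t \<in> T_sym} \<union> {(e, \<tau>) \<in> \<Xi>1. \<tau> \<notin> T_sym}"

fun B2 :: "point set \<times> point set \<Rightarrow> point \<Rightarrow> real" where
  "B2 (e, \<tau>) x =
     (if e = {} then \<Sum>e'\<in>edges_of \<tau>. 2/3 * B1 e' \<tau> x + 1/3 * B1 e' (other e' \<tau>) x
      else if \<exists>t\<in>T_sym. t \<in> attached e \<and> t \<noteq> \<tau> then 2/3 * B1 e \<tau> x + 1/3 * B1 e (other e \<tau>) x
      else B1 e \<tau> x)"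

definition vertex_idx :: "(point \<times> nat) set" where
  "vertex_idx = V \<times> {1..3}"

definition S2 :: "(point \<Rightarrow> real) set" where
  "S2 = real_fun.span (vertex_fun ` vertex_idx \<union> B2 ` \<Xi>2)"

definition all_idx :: "(point \<times> nat + point set \<times> point set) set" where
  "all_idx = vertex_idx <+> \<Xi>2"

definition B :: "point \<times> nat + point set \<times> point set \<Rightarrow> point \<Rightarrow> real" where
  "B = case_sum vertex_fun B2"

fun support_triangles :: "point \<times> nat + point set \<times> point set \<Rightarrow> point set set" where
  "support_triangles (Inl (v, r)) = {t \<in> T. v \<in> t}"
| "support_triangles (Inr (e, \<tau>)) = (if e = {} then insert \<tau> (neighbours \<tau>) else attached e)"

end

definition convex_partition_of_unity_on :: "point set \<Rightarrow> 'i set \<Rightarrow> ('i \<Rightarrow> point \<Rightarrow> real) \<Rightarrow> bool" where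
  "convex_partition_of_unity_on D I f \<longleftrightarrow>
     finite I \<and> (\<forall>x\<in>D. (\<forall>i\<in>I. 0 \<le> f i x) \<and> (\<Sum>i\<in>I. f i x) = 1)"

definition basis_of :: "(point \<Rightarrow> real) set \<Rightarrow> 'i set \<Rightarrow> ('i \<Rightarrow> point \<Rightarrow> real) \<Rightarrow> bool" where
  "basis_of S I f \<longleftrightarrow>
     inj_on f I \<and> real_fun.independent (f ` I) \<and> real_fun.span (f ` I) = S"

end

theory Submission
  imports Defs
begin

text \<open>Every function of the spline space is determined on a small triangle by ten ordinates, each
  an affine combination of coefficients. With all coefficients equal to 1 all ordinates are 1 and the
  cubic form is \<open>(u1 + u2 + u3)\<^sup>3 = 1\<close>; with nonnegative coefficients all ordinates are nonnegative,
  because the split points and the points in the triangles \<open>q\<close> have nonnegative barycentric coordinates.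
  If the function vanishes, so do the ordinates; three of them give the affine function \<open>L\<close> of a vertex
  at three non-collinear points, and then each remaining coefficient is a nonzero multiple of an ordinate.
  The second reduction replaces, at an edge of a symmetric triangle, two coefficients \<open>a, b\<close> by
  \<open>2/3 a + 1/3 b\<close> and \<open>1/3 a + 2/3 b\<close>, which is invertible and keeps sums of nonnegative weights equal
  to 1; this is applicable because such an edge is never a boundary edge.

  That the cubic forms fit together needs the small triangles to meet properly. In barycentric
  coordinates \<open>y\<close> with respect to a triangle \<open>t\<close> with split point \<open>a\<close>, the weight of the split point in
  the small triangle containing the point is \<open>min y/a\<close>, hence independent of the small triangle.\<close>

section \<open>Barycentric coordinates\<close>

text \<open>The obstacle is that \<open>spline\<close> is a definite description over all small
  triangles containing a point, so no value can be computed before conformity is settled. To this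
  end \<open>bary S p\<close> is a function on all points that is 0 off \<open>S\<close>:
  coordinates with respect to different triangles can be compared as functions, and edge-to-edge
  meeting says that a vertex with positive weight at a common point is a common vertex. In this form
  conformity passes from the faces of the coarse triangulation to refined triangles, which may lie
  in different coarse triangles, and on to the small triangles. It also bounds the number of
  triangles at an edge by two, without which \<open>other\<close> and the two-term weights at an
  edge would have no meaning. After that, a linear combination of the functions is rewritten as one
  \<open>spline\<close> with explicit coefficients, so that the sum and the independence are
  questions about coefficient vectors. At an edge the weights 2/3 and 1/3 form a symmetric matrix
  with row sums 1 and determinant 1/3: the former serves the partition of unity, the latter the
  independence.\<close>

lemma bary_eqI:
  assumes "\<not> affine_dependent S" "sum u S = 1" "(\<Sum>v\<in>S. u v *\<^sub>R v) = p"
    and "\<And>v. v \<notin> S \<Longrightarrow> u v = 0"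
  shows "bary S p = u"
  unfolding bary_def
proof (rule the_equality)
  fix w assume w: "sum w S = 1 \<and> (\<Sum>v\<in>S. w v *\<^sub>R v) = p \<and> (\<forall>v. v \<notin> S \<longrightarrow> w v = 0)"
  have fin: "finite S" using assms(1) aff_independent_finite by blast
  have "sum (\<lambda>v. w v - u v) S = 0" "(\<Sum>v\<in>S. (w v - u v) *\<^sub>R v) = 0"
    using w assms by (auto simp: sum_subtractf scaleR_left_diff_distrib)
  with assms(1) have "\<forall>v\<in>S. w v - u v = 0"
    unfolding affine_dependent_explicit_finite[OF fin] by blast
  with w assms(4) show "w = u" by (force simp: fun_eq_iff)
qed (use assms in auto)

lemma
  assumes "\<not> affine_dependent S" "p \<in> affine hull S"
  shows sum_bary: "sum (bary S p) S = 1"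
    and bary_combination: "(\<Sum>v\<in>S. bary S p v *\<^sub>R v) = p"
    and bary_outside: "v \<notin> S \<Longrightarrow> bary S p v = 0"
proof -
  have fin: "finite S" using assms(1) aff_independent_finite by blast
  obtain u where u: "sum u S = 1" "(\<Sum>v\<in>S. u v *\<^sub>R v) = p"
    using assms(2) by (auto simp: affine_hull_finite[OF fin])
  define w where "w v = (if v \<in> S then u v else 0)" for v
  have "sum w S = 1" "(\<Sum>v\<in>S. w v *\<^sub>R v) = p"
    using u by (auto simp: w_def cong: sum.cong)
  moreover have "bary S p = w"
    by (rule bary_eqI) (use assms calculation in \<open>auto simp: w_def\<close>)
  ultimately show "sum (bary S p) S = 1" "(\<Sum>v\<in>S. bary S p v *\<^sub>R v) = p"
    "v \<notin> S \<Longrightarrow> bary S p v = 0" by (auto simp: w_def)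
qed

lemma convex_hull_bary_iff:
  assumes "\<not> affine_dependent S" "p \<in> affine hull S"
  shows "p \<in> convex hull S \<longleftrightarrow> (\<forall>v. 0 \<le> bary S p v)"
proof
  have fin: "finite S" using assms(1) aff_independent_finite by blast
  assume "p \<in> convex hull S"
  then obtain u where u: "\<forall>x\<in>S. 0 \<le> u x" "sum u S = 1" "(\<Sum>v\<in>S. u v *\<^sub>R v) = p"
    by (auto simp: convex_hull_finite[OF fin])
  have "bary S p = (\<lambda>v. if v \<in> S then u v else 0)"
    by (rule bary_eqI) (use assms u in \<open>auto cong: sum.cong\<close>)
  with u show "\<forall>v. 0 \<le> bary S p v" by auto
next
  have fin: "finite S" using assms(1) aff_independent_finite by blast
  assume "\<forall>v. 0 \<le> bary S p v"
  then show "p \<in> convex hull S"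
    using sum_bary[OF assms] bary_combination[OF assms] by (auto simp: convex_hull_finite[OF fin])
qed

lemma convex_hull_bary:
  assumes "\<not> affine_dependent S" "p \<in> convex hull S"
  shows "sum (bary S p) S = 1" "(\<Sum>v\<in>S. bary S p v *\<^sub>R v) = p"
    "v \<notin> S \<Longrightarrow> bary S p v = 0" "0 \<le> bary S p v"
proof -
  have "p \<in> affine hull S"
    using assms(2) convex_hull_subset_affine_hull by blast
  then show "sum (bary S p) S = 1" "(\<Sum>v\<in>S. bary S p v *\<^sub>R v) = p"
    "v \<notin> S \<Longrightarrow> bary S p v = 0" "0 \<le> bary S p v"
    using assms sum_bary bary_combination bary_outside convex_hull_bary_iff by blast+
qed

lemma bary_pos_rel_interior:
  assumes "\<not> affine_dependent S" "p \<in> rel_interior (convex hull S)" "v \<in> S"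
  shows "0 < bary S p v"
proof -
  obtain u where u: "\<forall>x\<in>S. 0 < u x" "sum u S = 1" "(\<Sum>v\<in>S. u v *\<^sub>R v) = p"
    using assms(1,2) by (auto simp: rel_interior_convex_hull_explicit)
  have "bary S p = (\<lambda>v. if v \<in> S then u v else 0)"
    by (rule bary_eqI) (use assms u in \<open>auto cong: sum.cong\<close>)
  with u assms(3) show ?thesis by auto
qed

text \<open>Weighting the representations of the points of \<open>R\<close> by \<open>w\<close>
  yields a representation of \<open>x\<close>, and representations are unique. Coordinates are thus
  affine in the point.\<close>

lemma bary_combine:
  assumes S: "\<not> affine_dependent S" and fin: "finite R" and R: "R \<subseteq> affine hull S"
    and w: "sum w R = 1" "(\<Sum>p\<in>R. w p *\<^sub>R p) = x"
  shows "bary S x v = (\<Sum>p\<in>R. w p * bary S p v)"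
proof -
  have "bary S x = (\<lambda>v. \<Sum>p\<in>R. w p * bary S p v)"
  proof (rule bary_eqI[OF S])
    have "(\<Sum>v\<in>S. \<Sum>p\<in>R. w p * bary S p v) = (\<Sum>p\<in>R. w p * sum (bary S p) S)"
      unfolding sum_distrib_left by (rule sum.swap)
    also have "\<dots> = 1" using sum_bary[OF S] R w(1) by (simp add: subset_iff cong: sum.cong)
    finally show "(\<Sum>v\<in>S. \<Sum>p\<in>R. w p * bary S p v) = 1" .
    have "(\<Sum>v\<in>S. (\<Sum>p\<in>R. w p * bary S p v) *\<^sub>R v) = (\<Sum>p\<in>R. w p *\<^sub>R (\<Sum>v\<in>S. bary S p v *\<^sub>R v))"
      unfolding scaleR_sum_left scaleR_sum_right scaleR_scaleR by (rule sum.swap)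
    also have "\<dots> = x"
      unfolding w(2)[symmetric] by (rule sum.cong) (use bary_combination[OF S] R in auto)
    finally show "(\<Sum>v\<in>S. (\<Sum>p\<in>R. w p * bary S p v) *\<^sub>R v) = x" .
  qed (use bary_outside[OF S] R in \<open>auto simp: subset_iff intro!: sum.neutral\<close>)
  then show ?thesis by simp
qed

lemma finite_three: "finite {a, b, c}" by simp

text \<open>A coincidence of two points is itself a nontrivial relation with weights 1 and -1, so
  distinctness comes out together with independence.\<close>

lemma affine_independent_three:
  fixes a b c :: point
  assumes "\<forall>\<alpha> \<beta> \<gamma>. \<alpha> + \<beta> + \<gamma> = 0 \<longrightarrow> \<alpha> *\<^sub>R a + \<beta> *\<^sub>R b + \<gamma> *\<^sub>R c = 0
    \<longrightarrow> \<alpha> = 0 \<and> \<beta> = 0 \<and> \<gamma> = 0"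
  shows "a \<noteq> b" "a \<noteq> c" "b \<noteq> c" "\<not> affine_dependent {a, b, c}"
proof -
  show ab: "a \<noteq> b" using spec[OF spec[OF spec[OF assms, of 1], of "-1"], of 0] by simp
  show ac: "a \<noteq> c" using spec[OF spec[OF spec[OF assms, of 1], of 0], of "-1"] by simp
  show bc: "b \<noteq> c" using spec[OF spec[OF spec[OF assms, of 0], of 1], of "-1"] by simp
  show "\<not> affine_dependent {a, b, c}"
  proof
    assume "affine_dependent {a, b, c}"
    then obtain u where u: "sum u {a, b, c} = 0" "\<exists>v\<in>{a, b, c}. u v \<noteq> 0" "(\<Sum>v\<in>{a, b, c}. u v *\<^sub>R v) = 0"
      unfolding affine_dependent_explicit_finite[OF finite_three] by blast
    have "u a + u b + u c = 0" "u a *\<^sub>R a + u b *\<^sub>R b + u c *\<^sub>R c = 0"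
      using u(1,3) ab ac bc by (simp_all add: add.assoc)
    with assms u(2) show False by blast
  qed
qed

lemma affine_independent_threeD:
  fixes a b c :: point
  assumes "\<not> affine_dependent {a, b, c}" "a \<noteq> b" "a \<noteq> c" "b \<noteq> c"
    and "\<alpha> + \<beta> + \<gamma> = 0" "\<alpha> *\<^sub>R a + \<beta> *\<^sub>R b + \<gamma> *\<^sub>R c = 0"
  shows "\<alpha> = 0" "\<beta> = 0" "\<gamma> = 0"
proof -
  let ?u = "\<lambda>v. if v = a then \<alpha> else if v = b then \<beta> else \<gamma>"
  have "sum ?u {a, b, c} = 0" "(\<Sum>v\<in>{a, b, c}. ?u v *\<^sub>R v) = 0"
    using assms by (auto simp: add.assoc)
  then have "\<forall>v\<in>{a, b, c}. ?u v = 0"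
    using assms(1) unfolding affine_dependent_explicit_finite[OF finite_three] by blast
  then show "\<alpha> = 0" "\<beta> = 0" "\<gamma> = 0" using assms(2-4) by auto
qed

text \<open>The intersection is a face of both simplices, hence the hull of some vertices of
  \<open>s\<close> and of some vertices of \<open>t\<close>. Both are its extreme points, so they
  coincide, and both coordinate functions are those of this common face.\<close>

lemma bary_eq_common_face:
  assumes "\<not> affine_dependent s" "\<not> affine_dependent t"
    and "(convex hull s \<inter> convex hull t) face_of convex hull s"
    and "(convex hull s \<inter> convex hull t) face_of convex hull t"
    and "x \<in> convex hull s" "x \<in> convex hull t"
  shows "bary s x = bary t x"
proof -
  obtain a b where a: "a \<subseteq> s" "convex hull s \<inter> convex hull t = convex hull a"
    and b: "b \<subseteq> t" "convex hull s \<inter> convex hull t = convex hull b"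
    using assms(3,4) by (auto simp: face_of_convex_hull_affine_independent assms(1,2))
  have ia: "\<not> affine_dependent a" and ib: "\<not> affine_dependent b"
    using a b assms(1,2) affine_dependent_subset by blast+
  have ab: "a = b"
    using extreme_point_of_convex_hull_affine_independent[OF ia]
      extreme_point_of_convex_hull_affine_independent[OF ib] a(2) b(2) by auto
  have x: "x \<in> convex hull a" using assms(5,6) a(2) by auto
  have fin: "finite s" "finite t" using assms(1,2) aff_independent_finite by auto
  note h = convex_hull_bary[OF ia x]
  have "bary s x = bary a x"
    by (rule bary_eqI[OF assms(1)])
      (use a(1) h fin in \<open>auto simp: sum.mono_neutral_right[of s a]\<close>)
  moreover have "bary t x = bary a x"
    by (rule bary_eqI[OF assms(2)])
      (use b(1) h fin ab in \<open>auto simp: sum.mono_neutral_right[of t a]\<close>)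
  ultimately show ?thesis by simp
qed

section \<open>The uniform refinement\<close>

locale triangle =
  fixes a b c :: point
  assumes dist: "a \<noteq> b" "a \<noteq> c" "b \<noteq> c" and indep: "\<not> affine_dependent {a, b, c}"
begin

lemma bary_three:
  assumes "\<alpha> + \<beta> + \<gamma> = 1"
  shows "bary {a, b, c} (\<alpha> *\<^sub>R a + \<beta> *\<^sub>R b + \<gamma> *\<^sub>R c) =
    (\<lambda>v. if v = a then \<alpha> else if v = b then \<beta> else if v = c then \<gamma> else 0)"
  by (rule bary_eqI[OF indep]) (use dist assms in \<open>auto simp: add.assoc\<close>)

lemma lattice_point_eq:
  "lattice_point l a b c i j =
    (1 - real i / real l - real j / real l) *\<^sub>R a + (real i / real l) *\<^sub>R b + (real j / real l) *\<^sub>R c"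
  by (simp add: lattice_point_def algebra_simps)

lemma bary_lattice_point:
  "bary {a, b, c} (lattice_point l a b c i j) = (\<lambda>v. if v = a then 1 - real i / real l - real j / real l
     else if v = b then real i / real l else if v = c then real j / real l else 0)"
  unfolding lattice_point_eq by (rule bary_three) simp

lemma lattice_point_in_hull:
  assumes "i + j \<le> l" "l \<ge> 1"
  shows "lattice_point l a b c i j \<in> convex hull {a, b, c}"
proof -
  have "real i / real l + real j / real l \<le> 1"
    using assms by (simp add: add_divide_distrib[symmetric] flip: of_nat_add)
  then show ?thesis
    unfolding lattice_point_eq convex_hull_3
    by (intro CollectI exI[of _ "1 - real i / real l - real j / real l"] exI[of _ "real i / real l"]
        exI[of _ "real j / real l"]) auto
qed

lemma eq_lattice_point_iff:
  assumes p: "p \<in> convex hull {a, b, c}" and l: "l \<ge> 1"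
  shows "p = lattice_point l a b c i j \<longleftrightarrow>
    real l * bary {a, b, c} p b = real i \<and> real l * bary {a, b, c} p c = real j"
proof
  assume "p = lattice_point l a b c i j"
  then show "real l * bary {a, b, c} p b = real i \<and> real l * bary {a, b, c} p c = real j"
    using dist l by (simp add: bary_lattice_point)
next
  assume *: "real l * bary {a, b, c} p b = real i \<and> real l * bary {a, b, c} p c = real j"
  obtain u v w where uvw: "u + v + w = 1" "p = u *\<^sub>R a + v *\<^sub>R b + w *\<^sub>R c"
    using p by (auto simp: convex_hull_3)
  have "v = real i / real l" "w = real j / real l"
    using * dist l unfolding uvw(2) bary_three[OF uvw(1)] by (auto simp: field_simps)
  moreover from this have "u = 1 - real i / real l - real j / real l" using uvw(1) by simp
  ultimately show "p = lattice_point l a b c i j" unfolding lattice_point_eq uvw(2) by simp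
qed

text \<open>Weights with sum 0 cancel the constant part of the grid points; independence of
  \<open>a\<close>, \<open>b\<close>, \<open>c\<close> then leaves one relation for each of the two
  grid indices.\<close>

lemma lattice_independent:
  fixes \<alpha> \<beta> \<gamma> :: real
  assumes "l \<ge> 1" "\<alpha> + \<beta> + \<gamma> = 0"
    and "\<alpha> *\<^sub>R lattice_point l a b c i1 j1 + \<beta> *\<^sub>R lattice_point l a b c i2 j2
       + \<gamma> *\<^sub>R lattice_point l a b c i3 j3 = 0"
  shows "\<alpha> * i1 + \<beta> * i2 + \<gamma> * i3 = 0" "\<alpha> * j1 + \<beta> * j2 + \<gamma> * j3 = 0"
proof -
  define y where "y = (\<alpha> * i1 + \<beta> * i2 + \<gamma> * i3) / l"
  define z where "z = (\<alpha> * j1 + \<beta> * j2 + \<gamma> * j3) / l"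
  have "\<alpha> *\<^sub>R lattice_point l a b c i1 j1 + \<beta> *\<^sub>R lattice_point l a b c i2 j2
       + \<gamma> *\<^sub>R lattice_point l a b c i3 j3 = ((\<alpha> + \<beta> + \<gamma>) - y - z) *\<^sub>R a + y *\<^sub>R b + z *\<^sub>R c"
    unfolding lattice_point_eq y_def z_def
    by (simp add: algebra_simps add_divide_distrib)
  then have "(- y - z) *\<^sub>R a + y *\<^sub>R b + z *\<^sub>R c = 0" using assms(2,3) by simp
  from affine_independent_threeD[OF indep dist _ this] have "y = 0" "z = 0" by auto
  then show "\<alpha> * i1 + \<beta> * i2 + \<gamma> * i3 = 0" "\<alpha> * j1 + \<beta> * j2 + \<gamma> * j3 = 0"
    using assms(1) by (auto simp: y_def z_def)
qed

lemma upright_independent: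
  assumes "l \<ge> 1"
  shows "card {lattice_point l a b c i j, lattice_point l a b c (i+1) j, lattice_point l a b c i (j+1)} = 3"
    and "\<not> affine_dependent {lattice_point l a b c i j, lattice_point l a b c (i+1) j, lattice_point l a b c i (j+1)}"
proof -
  have *: "\<forall>\<alpha> \<beta> \<gamma>. \<alpha> + \<beta> + \<gamma> = 0 \<longrightarrow> \<alpha> *\<^sub>R lattice_point l a b c i j
    + \<beta> *\<^sub>R lattice_point l a b c (i+1) j + \<gamma> *\<^sub>R lattice_point l a b c i (j+1) = 0
    \<longrightarrow> \<alpha> = 0 \<and> \<beta> = 0 \<and> \<gamma> = 0"
  proof (intro allI impI)
    fix \<alpha> \<beta> \<gamma> :: real
    assume s: "\<alpha> + \<beta> + \<gamma> = 0" "\<alpha> *\<^sub>R lattice_point l a b c i j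
    + \<beta> *\<^sub>R lattice_point l a b c (i+1) j + \<gamma> *\<^sub>R lattice_point l a b c i (j+1) = 0"
    have "(\<alpha> + \<beta> + \<gamma>) * i + \<beta> = 0" "(\<alpha> + \<beta> + \<gamma>) * j + \<gamma> = 0"
      using lattice_independent[OF assms s] by (simp_all add: algebra_simps)
    with s(1) show "\<alpha> = 0 \<and> \<beta> = 0 \<and> \<gamma> = 0" by simp
  qed
  note ** = affine_independent_three[OF *]
  show "card {lattice_point l a b c i j, lattice_point l a b c (i+1) j, lattice_point l a b c i (j+1)} = 3"
    unfolding card_3_iff using **(1-3) by blast
  show "\<not> affine_dependent {lattice_point l a b c i j, lattice_point l a b c (i+1) j, lattice_point l a b c i (j+1)}"
    by (rule **(4))
qed

lemma inverted_independent:
  assumes "l \<ge> 1"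
  shows "card {lattice_point l a b c (i+1) j, lattice_point l a b c i (j+1), lattice_point l a b c (i+1) (j+1)} = 3"
    and "\<not> affine_dependent {lattice_point l a b c (i+1) j, lattice_point l a b c i (j+1), lattice_point l a b c (i+1) (j+1)}"
proof -
  have *: "\<forall>\<alpha> \<beta> \<gamma>. \<alpha> + \<beta> + \<gamma> = 0 \<longrightarrow> \<alpha> *\<^sub>R lattice_point l a b c (i+1) j
    + \<beta> *\<^sub>R lattice_point l a b c i (j+1) + \<gamma> *\<^sub>R lattice_point l a b c (i+1) (j+1) = 0
    \<longrightarrow> \<alpha> = 0 \<and> \<beta> = 0 \<and> \<gamma> = 0"
  proof (intro allI impI)
    fix \<alpha> \<beta> \<gamma> :: real
    assume s: "\<alpha> + \<beta> + \<gamma> = 0" "\<alpha> *\<^sub>R lattice_point l a b c (i+1) j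
    + \<beta> *\<^sub>R lattice_point l a b c i (j+1) + \<gamma> *\<^sub>R lattice_point l a b c (i+1) (j+1) = 0"
    have "(\<alpha> + \<beta> + \<gamma>) * i + (\<alpha> + \<gamma>) = 0" "(\<alpha> + \<beta> + \<gamma>) * j + (\<beta> + \<gamma>) = 0"
      using lattice_independent[OF assms s] by (simp_all add: algebra_simps)
    with s(1) show "\<alpha> = 0 \<and> \<beta> = 0 \<and> \<gamma> = 0" by simp
  qed
  note ** = affine_independent_three[OF *]
  show "card {lattice_point l a b c (i+1) j, lattice_point l a b c i (j+1), lattice_point l a b c (i+1) (j+1)} = 3"
    unfolding card_3_iff using **(1-3) by blast
  show "\<not> affine_dependent {lattice_point l a b c (i+1) j, lattice_point l a b c i (j+1), lattice_point l a b c (i+1) (j+1)}"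
    by (rule **(4))
qed

end

text \<open>The refinement is cut out by the lines on which some scaled barycentric coordinate is an integer:
  its triangles are the sets of grid points whose coordinates lie between consecutive integers. Described
  like this, they depend only on barycentric coordinates, which agree on common points of two triangles.\<close>

definition cell :: "nat \<Rightarrow> point set \<Rightarrow> (point \<Rightarrow> int) \<Rightarrow> point set" where
  "cell l t n = {p \<in> convex hull t. \<forall>v\<in>t. \<exists>k\<in>{n v, n v + 1}. real l * bary t p v = of_int k}"

context triangle
begin

lemma in_hull_sum:
  assumes "p \<in> convex hull {a, b, c}"
  shows "bary {a, b, c} p a + bary {a, b, c} p b + bary {a, b, c} p c = 1"
  using convex_hull_bary(1)[OF indep assms] dist by (simp add: add.assoc)

text \<open>The scaled coordinates of a point sum to \<open>l\<close>, the three lower bounds in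
  \<open>n\<close> to \<open>l - 1\<close>. Hence exactly one coordinate takes its upper value, and
  the three choices are the three vertices.\<close>

lemma upright_cell:
  assumes "i + j < l"
  defines "n \<equiv> \<lambda>v. if v = a then int l - 1 - int i - int j else if v = b then int i else int j"
  shows "{lattice_point l a b c i j, lattice_point l a b c (i+1) j, lattice_point l a b c i (j+1)}
    = cell l {a, b, c} n" (is "?L = _")
proof
  have l: "l \<ge> 1" using assms by simp
  have mem: "lattice_point l a b c i' j' \<in> cell l {a, b, c} n"
    if "(i', j') \<in> {(i, j), (i+1, j), (i, j+1)}" for i' j'
  proof -
    have "lattice_point l a b c i' j' \<in> convex hull {a, b, c}"
      using that assms by (intro lattice_point_in_hull) auto
    then show ?thesis
      using that dist l by (auto simp: cell_def bary_lattice_point n_def field_simps)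
  qed
  then show "?L \<subseteq> cell l {a, b, c} n" by simp
  show "cell l {a, b, c} n \<subseteq> ?L"
  proof
    fix p assume "p \<in> cell l {a, b, c} n"
    then have p: "p \<in> convex hull {a, b, c}"
      and ex: "\<forall>v\<in>{a, b, c}. \<exists>k\<in>{n v, n v + 1}. real l * bary {a, b, c} p v = of_int k"
      by (auto simp: cell_def)
    have "\<exists>k\<in>{n a, n a + 1}. real l * bary {a, b, c} p a = of_int k"
      "\<exists>k\<in>{n b, n b + 1}. real l * bary {a, b, c} p b = of_int k"
      "\<exists>k\<in>{n c, n c + 1}. real l * bary {a, b, c} p c = of_int k"
      using ex by blast+
    then obtain ka kb kc where k: "ka \<in> {n a, n a + 1}" "kb \<in> {n b, n b + 1}" "kc \<in> {n c, n c + 1}"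
      "real l * bary {a, b, c} p a = of_int ka" "real l * bary {a, b, c} p b = of_int kb"
      "real l * bary {a, b, c} p c = of_int kc"
      by (elim bexE) blast
    have "real_of_int (ka + kb + kc) = real l"
      using arg_cong[OF in_hull_sum[OF p], of "\<lambda>x. real l * x"] k(4-6) by (simp add: algebra_simps)
    then have sum: "ka + kb + kc = int l" by linarith
    consider "kb = int i" "kc = int j" | "kb = int (i+1)" "kc = int j" | "kb = int i" "kc = int (j+1)"
      using k(1-3) sum dist by (auto simp: n_def)
    then show "p \<in> ?L" using eq_lattice_point_iff[OF p l] k(5,6) by cases auto
  qed
qed

text \<open>Here the lower bounds sum to \<open>l - 2\<close>, so exactly two of the coordinates
  take their upper values.\<close>

lemma inverted_cell:
  assumes "i + j + 1 < l"
  defines "n \<equiv> \<lambda>v. if v = a then int l - 2 - int i - int j else if v = b then int i else int j"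
  shows "{lattice_point l a b c (i+1) j, lattice_point l a b c i (j+1), lattice_point l a b c (i+1) (j+1)}
    = cell l {a, b, c} n" (is "?L = _")
proof
  have l: "l \<ge> 1" using assms by simp
  have mem: "lattice_point l a b c i' j' \<in> cell l {a, b, c} n"
    if "(i', j') \<in> {(i+1, j), (i, j+1), (i+1, j+1)}" for i' j'
  proof -
    have "lattice_point l a b c i' j' \<in> convex hull {a, b, c}"
      using that assms by (intro lattice_point_in_hull) auto
    then show ?thesis
      using that dist l by (auto simp: cell_def bary_lattice_point n_def field_simps)
  qed
  then show "?L \<subseteq> cell l {a, b, c} n" by simp
  show "cell l {a, b, c} n \<subseteq> ?L"
  proof
    fix p assume "p \<in> cell l {a, b, c} n"
    then have p: "p \<in> convex hull {a, b, c}"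
      and ex: "\<forall>v\<in>{a, b, c}. \<exists>k\<in>{n v, n v + 1}. real l * bary {a, b, c} p v = of_int k"
      by (auto simp: cell_def)
    have "\<exists>k\<in>{n a, n a + 1}. real l * bary {a, b, c} p a = of_int k"
      "\<exists>k\<in>{n b, n b + 1}. real l * bary {a, b, c} p b = of_int k"
      "\<exists>k\<in>{n c, n c + 1}. real l * bary {a, b, c} p c = of_int k"
      using ex by blast+
    then obtain ka kb kc where k: "ka \<in> {n a, n a + 1}" "kb \<in> {n b, n b + 1}" "kc \<in> {n c, n c + 1}"
      "real l * bary {a, b, c} p a = of_int ka" "real l * bary {a, b, c} p b = of_int kb"
      "real l * bary {a, b, c} p c = of_int kc"
      by (elim bexE) blast
    have "real_of_int (ka + kb + kc) = real l"
      using arg_cong[OF in_hull_sum[OF p], of "\<lambda>x. real l * x"] k(4-6) by (simp add: algebra_simps)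
    then have sum: "ka + kb + kc = int l" by linarith
    consider "kb = int (i+1)" "kc = int j" | "kb = int i" "kc = int (j+1)" | "kb = int (i+1)" "kc = int (j+1)"
      using k(1-3) sum dist by (auto simp: n_def)
    then show "p \<in> ?L" using eq_lattice_point_iff[OF p l] k(5,6) by cases auto
  qed
qed

text \<open>The integer parts \<open>i\<close>, \<open>j\<close> of the scaled coordinates select a
  parallelogram of the grid; the fractional parts \<open>f\<close>, \<open>g\<close> decide on which
  side of its diagonal \<open>f + g = 1\<close> the point lies.\<close>

lemma ex_refine_hull:
  assumes l: "l \<ge> 1" and abc: "{a, b, c} \<in> \<D>" and x: "x \<in> convex hull {a, b, c}"
  shows "\<exists>\<tau>\<in>refine l \<D>. x \<in> convex hull \<tau>"
proof -
  obtain u v w where uvw: "0 \<le> u" "0 \<le> v" "0 \<le> w" "u + v + w = 1" "x = u *\<^sub>R a + v *\<^sub>R b + w *\<^sub>R c"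
    using x by (auto simp: convex_hull_3)
  define i j where "i = nat \<lfloor>l * v\<rfloor>" and "j = nat \<lfloor>l * w\<rfloor>"
  define f g where "f = l * v - i" and "g = l * w - j"
  have fg: "0 \<le> f" "f < 1" "0 \<le> g" "g < 1"
    using uvw l by (auto simp: f_def g_def i_def j_def) linarith+
  have sum: "l * u + (i + f) + (j + g) = l"
    unfolding f_def g_def using uvw(4) by (simp flip: distrib_left)
  have vw: "v = (i + f) / l" "w = (j + g) / l" using l by (auto simp: f_def g_def)
  have lu: "0 \<le> l * u" using uvw(1) by simp
  have up: "{lattice_point l a b c i j, lattice_point l a b c (i+1) j, lattice_point l a b c i (j+1)} \<in> refine l \<D>"
    if "i + j < l" for i j
    unfolding refine_def using abc that by blast
  have down: "{lattice_point l a b c (i+1) j, lattice_point l a b c i (j+1), lattice_point l a b c (i+1) (j+1)} \<in> refine l \<D>"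
    if "i + j + 1 < l" for i j
    unfolding refine_def using abc that by blast
  have xeq: "x = a + v *\<^sub>R (b - a) + w *\<^sub>R (c - a)"
  proof -
    have u: "u = 1 - v - w" using uvw(4) by simp
    show ?thesis unfolding uvw(5) u by (simp add: algebra_simps)
  qed
  have lc: "\<alpha> *\<^sub>R lattice_point l a b c i1 j1 + \<beta> *\<^sub>R lattice_point l a b c i2 j2 + \<gamma> *\<^sub>R lattice_point l a b c i3 j3 = x"
    if "\<alpha> + \<beta> + \<gamma> = 1" "\<alpha> * i1 + \<beta> * i2 + \<gamma> * i3 = i + f" "\<alpha> * j1 + \<beta> * j2 + \<gamma> * j3 = j + g"
    for \<alpha> \<beta> \<gamma> i1 j1 i2 j2 i3 j3
  proof -
    have "\<alpha> *\<^sub>R lattice_point l a b c i1 j1 + \<beta> *\<^sub>R lattice_point l a b c i2 j2 + \<gamma> *\<^sub>R lattice_point l a b c i3 j3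
      = (\<alpha> + \<beta> + \<gamma>) *\<^sub>R a + ((\<alpha> * i1 + \<beta> * i2 + \<gamma> * i3) / l) *\<^sub>R (b - a) + ((\<alpha> * j1 + \<beta> * j2 + \<gamma> * j3) / l) *\<^sub>R (c - a)"
      unfolding lattice_point_def by (simp add: scaleR_add_left scaleR_add_right add_divide_distrib)
    then show ?thesis unfolding xeq vw using that by simp
  qed
  consider "i + j < l" "f + g \<le> 1" | "f + g > 1" | "i + j \<ge> l" "f + g \<le> 1" by linarith
  then show ?thesis
  proof cases
    case 1
    have "x \<in> convex hull {lattice_point l a b c i j, lattice_point l a b c (i+1) j, lattice_point l a b c i (j+1)}"
      unfolding convex_hull_3
      by (intro CollectI exI[of _ "1 - f - g"] exI[of _ f] exI[of _ g] conjI lc[symmetric])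
        (use 1 fg in \<open>auto simp: algebra_simps\<close>)
    with up[OF 1(1)] show ?thesis by blast
  next
    case 2
    then have "i + j + 1 < l" using sum lu by linarith
    \<comment> \<open>The weights \<open>1 - g\<close>, \<open>1 - f\<close>,
      \<open>f + g - 1\<close> solve the two index equations required by \<open>lc\<close>; the last
      one is positive exactly beyond the diagonal.\<close>
    moreover have "x \<in> convex hull {lattice_point l a b c (i+1) j, lattice_point l a b c i (j+1), lattice_point l a b c (i+1) (j+1)}"
      unfolding convex_hull_3
      by (intro CollectI exI[of _ "1 - g"] exI[of _ "1 - f"] exI[of _ "f + g - 1"] conjI lc[symmetric])
        (use 2 fg in \<open>auto simp: algebra_simps\<close>)
    ultimately show ?thesis using down by blast
  next
    case 3
    then have z: "f = 0" "g = 0" "i + j = l" using sum lu fg by linarith+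
    then have xl: "x = lattice_point l a b c i j" using lc[of 1 0 0 i i i j j j] by simp
    \<comment> \<open>The point is a grid point on the side opposite to \<open>a\<close>, where no
      upright triangle starts. One of its indices is positive since \<open>i + j = l\<close>, and
      lowering that index by 1 gives an upright triangle with this point as a vertex.\<close>
    consider i' where "i = i' + 1" | j' where "j = j' + 1"
      using z(3) l by (metis Suc_eq_plus1 add_is_0 not_one_le_zero old.nat.exhaust)
    then show ?thesis
    proof cases
      case 1
      then have "x \<in> convex hull {lattice_point l a b c i' j, lattice_point l a b c (i'+1) j, lattice_point l a b c i' (j+1)}"
        unfolding xl by (intro hull_inc) auto
      with up[of i' j] 1 z(3) show ?thesis by auto
    next
      case 2
      then have "x \<in> convex hull {lattice_point l a b c i j', lattice_point l a b c (i+1) j', lattice_point l a b c i (j'+1)}"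
        unfolding xl by (intro hull_inc) auto
      with up[of i j'] 2 z(3) show ?thesis by auto
    qed
  qed
qed

end

lemma triangleI:
  assumes "card {a, b, c :: point} = 3" "\<not> affine_dependent {a, b, c}"
  shows "triangle a b c"
proof
  show "a \<noteq> b" "a \<noteq> c" "b \<noteq> c" using assms(1) by (auto simp: insert_commute card_insert_if split: if_splits)
qed (rule assms(2))

section \<open>Edge-to-edge meeting of the refined triangles\<close>

context
  fixes \<D> :: "point set set" and \<Omega> :: "point set" and l :: nat
  assumes D: "triangulates \<D> \<Omega>" and l: "l \<ge> 1"
begin

lemma triangulates_triangle: "t \<in> \<D> \<Longrightarrow> card t = 3" "t \<in> \<D> \<Longrightarrow> \<not> affine_dependent t"
  using D by (auto simp: triangulates_def)

lemma triangulates_bary_eq: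
  assumes "s \<in> \<D>" "t \<in> \<D>" "x \<in> convex hull s" "x \<in> convex hull t"
  shows "bary s x = bary t x"
proof (rule bary_eq_common_face)
  show "\<not> affine_dependent s" "\<not> affine_dependent t" using assms triangulates_triangle by auto
  have tri: "triangulation ((\<lambda>t. convex hull t) ` \<D>)" using D by (auto simp: triangulates_def)
  show "(convex hull s \<inter> convex hull t) face_of convex hull s"
    using tri assms unfolding triangulation_def by blast
  show "(convex hull s \<inter> convex hull t) face_of convex hull t"
    using tri assms unfolding triangulation_def by (metis Int_commute imageI)
qed (use assms in auto)

text \<open>\<open>triangulation\<close> speaks of the hulls, whereas this is about vertex sets; the
  vertices are recovered as the extreme points of the hull.\<close>

lemma triangulates_finite: "finite \<D>"
proof (rule finite_imageD)
  show "finite ((\<lambda>t. convex hull t) ` \<D>)"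
    using D by (auto simp: triangulates_def triangulation_def)
  show "inj_on (\<lambda>t. convex hull t) \<D>"
  proof (rule inj_onI)
    fix s t assume st: "s \<in> \<D>" "t \<in> \<D>" "convex hull s = convex hull t"
    then have "v \<in> s \<longleftrightarrow> v \<in> t" for v
      using extreme_point_of_convex_hull_affine_independent[OF triangulates_triangle(2)] by metis
    then show "s = t" by blast
  qed
qed

lemma refine_cell:
  assumes "\<tau> \<in> refine l \<D>"
  obtains t n where "t \<in> \<D>" "\<tau> = cell l t n" "card \<tau> = 3" "\<not> affine_dependent \<tau>"
proof -
  from assms consider
    (up) a b c i j where "{a, b, c} \<in> \<D>" "i + j < l"
      "\<tau> = {lattice_point l a b c i j, lattice_point l a b c (i+1) j, lattice_point l a b c i (j+1)}"
    | (down) a b c i j where "{a, b, c} \<in> \<D>" "i + j + 1 < l"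
      "\<tau> = {lattice_point l a b c (i+1) j, lattice_point l a b c i (j+1), lattice_point l a b c (i+1) (j+1)}"
    unfolding refine_def by blast
  then show ?thesis
  proof cases
    case up
    interpret triangle a b c using up(1) triangulates_triangle by (intro triangleI) auto
    show ?thesis
      using upright_cell[OF up(2)] upright_independent[OF l, of i j] unfolding up(3)[symmetric]
      by (rule that[OF up(1)])
  next
    case down
    interpret triangle a b c using down(1) triangulates_triangle by (intro triangleI) auto
    show ?thesis
      using inverted_cell[OF down(2)] inverted_independent[OF l, of i j] unfolding down(3)[symmetric]
      by (rule that[OF down(1)])
  qed
qed

lemma finite_refine: "finite (refine l \<D>)"
proof -
  let ?P = "\<Union>\<D>"
  have P: "finite ?P" using triangulates_finite triangulates_triangle(1) by (intro finite_Union) (auto intro: card_ge_0_finite)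
  define L where "L = (\<lambda>(a, b, c, i, j). lattice_point l a b c i j) ` (?P \<times> ?P \<times> ?P \<times> {..l} \<times> {..l})"
  have L: "lattice_point l a b c i j \<in> L" if "{a, b, c} \<in> \<D>" "i \<le> l" "j \<le> l" for a b c i j
  proof -
    have "a \<in> ?P" "b \<in> ?P" "c \<in> ?P" by (rule UnionI[OF that(1)], simp)+
    then show ?thesis using that(2,3) unfolding L_def
      by (intro image_eqI[of _ _ "(a, b, c, i, j)"]) auto
  qed
  have "refine l \<D> \<subseteq> Pow L"
    unfolding refine_def using L by auto
  moreover have "finite L" unfolding L_def using P by auto
  ultimately show ?thesis by (meson finite_Pow_iff finite_subset)
qed

text \<open>The scaled coordinates of two vertices of a cell differ by at most 1. The point
  \<open>x\<close> is an average of the vertices in which the term of \<open>p\<close> itself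
  contributes 0 to the deviation, and since \<open>p\<close> has positive weight, the bound becomes
  strict.\<close>

lemma cell_bary_dist:
  assumes t: "t \<in> \<D>" and \<tau>: "\<tau> = cell l t n" "finite \<tau>" "\<not> affine_dependent \<tau>"
    and x: "x \<in> convex hull \<tau>" and p: "p \<in> \<tau>" "0 < bary \<tau> x p"
  shows "\<bar>l * bary t x v - l * bary t p v\<bar> < 1"
proof -
  have it: "\<not> affine_dependent t" using t triangulates_triangle by auto
  have sub: "\<tau> \<subseteq> convex hull t" using \<tau>(1) by (auto simp: cell_def)
  have sub': "\<tau> \<subseteq> affine hull t" using sub convex_hull_subset_affine_hull by blast
  note h = convex_hull_bary[OF \<tau>(3) x]
  have eq: "bary t x v = (\<Sum>r\<in>\<tau>. bary \<tau> x r * bary t r v)"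
    by (rule bary_combine[OF it \<tau>(2) sub' h(1,2)])
  have d: "\<bar>l * bary t r v - l * bary t p v\<bar> \<le> 1" if r: "r \<in> \<tau>" for r
  proof (cases "v \<in> t")
    case True
    then obtain k k' where "k \<in> {n v, n v + 1}" "real l * bary t r v = of_int k"
      "k' \<in> {n v, n v + 1}" "real l * bary t p v = of_int k'"
      using r p(1) \<tau>(1) unfolding cell_def by blast
    then show ?thesis by auto
  next
    case False
    then have "bary t r v = 0" "bary t p v = 0"
      using convex_hull_bary(3)[OF it] sub r p(1) by auto
    then show ?thesis by simp
  qed
  have "(\<Sum>r\<in>\<tau>. bary \<tau> x r * (l * bary t p v)) = l * bary t p v"
    using h(1) by (simp flip: sum_distrib_right)
  then have "l * bary t x v - l * bary t p v = (\<Sum>r\<in>\<tau>. bary \<tau> x r * (l * bary t r v - l * bary t p v))"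
    unfolding eq by (simp add: right_diff_distrib sum_subtractf sum_distrib_left mult.left_commute)
  also have "\<dots> = (\<Sum>r\<in>\<tau> - {p}. bary \<tau> x r * (l * bary t r v - l * bary t p v))"
    using p(1) \<tau>(2) by (subst sum.remove[of _ p]) auto
  also have "\<bar>\<dots>\<bar> \<le> (\<Sum>r\<in>\<tau> - {p}. \<bar>bary \<tau> x r * (l * bary t r v - l * bary t p v)\<bar>)"
    by (rule sum_abs)
  also have "\<dots> \<le> (\<Sum>r\<in>\<tau> - {p}. bary \<tau> x r)"
  proof (rule sum_mono)
    fix r assume "r \<in> \<tau> - {p}"
    then show "\<bar>bary \<tau> x r * (l * bary t r v - l * bary t p v)\<bar> \<le> bary \<tau> x r"
      using mult_left_mono[OF d h(4)[of r]] h(4)[of r] by (simp add: abs_mult)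
  qed
  also have "\<dots> < 1" using h(1) p \<tau>(2) by (simp add: sum.remove[of \<tau> p])
  finally show ?thesis .
qed

text \<open>At \<open>x\<close> the scaled coordinate lies in \<open>[n v, n v + 1]\<close>. An
  integer at distance less than 1 from it lies strictly between \<open>n v - 1\<close> and
  \<open>n v + 2\<close>, which leaves the two values allowed in \<open>cell\<close>. The strictness
  supplied by \<open>cell_bary_dist\<close> is essential.\<close>

lemma cell_vertexI:
  assumes t: "t \<in> \<D>" and \<tau>: "\<tau> = cell l t n" "finite \<tau>" "\<not> affine_dependent \<tau>"
    and x: "x \<in> convex hull \<tau>" and p: "p \<in> convex hull t"
    and int: "\<And>v. v \<in> t \<Longrightarrow> l * bary t p v \<in> \<int>" and d: "\<And>v. \<bar>l * bary t x v - l * bary t p v\<bar> < 1"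
  shows "p \<in> \<tau>"
  unfolding \<tau>(1) cell_def
proof (intro CollectI conjI ballI p)
  fix v assume v: "v \<in> t"
  have it: "\<not> affine_dependent t" using t triangulates_triangle by auto
  have sub: "\<tau> \<subseteq> affine hull t"
    using \<tau>(1) convex_hull_subset_affine_hull by (auto simp: cell_def)
  note h = convex_hull_bary[OF \<tau>(3) x]
  have b: "n v \<le> l * bary t r v" "l * bary t r v \<le> n v + 1" if "r \<in> \<tau>" for r
    using that v \<tau>(1) by (auto simp: cell_def)
  have eq: "l * bary t x v = (\<Sum>r\<in>\<tau>. bary \<tau> x r * (l * bary t r v))"
    using bary_combine[OF it \<tau>(2) sub h(1,2)] by (simp add: sum_distrib_left algebra_simps)
  have "n v = (\<Sum>r\<in>\<tau>. bary \<tau> x r * n v)" using h(1) by (simp flip: sum_distrib_right)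
  also have "\<dots> \<le> l * bary t x v"
    unfolding eq by (intro sum_mono mult_left_mono b h(4))
  finally have 1: "n v \<le> l * bary t x v" .
  have "l * bary t x v \<le> (\<Sum>r\<in>\<tau>. bary \<tau> x r * (n v + 1))"
    unfolding eq using b(2) by (intro sum_mono mult_left_mono h(4)) auto
  also have "\<dots> = n v + 1" using h(1) by (simp flip: sum_distrib_right)
  finally have 2: "l * bary t x v \<le> n v + 1" .
  obtain k where k: "l * bary t p v = of_int k" using int[OF v] by (auto elim: Ints_cases)
  have "real_of_int (n v - 1) < k" "k < real_of_int (n v + 2)" using 1 2 d[of v] k by auto
  then have "n v - 1 < k" "k < n v + 2" by linarith+
  then have "k \<in> {n v, n v + 1}" by auto
  with k show "\<exists>k\<in>{n v, n v + 1}. real l * bary t p v = of_int k" by blast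
qed

text \<open>The coordinates of \<open>x\<close> are the same in both coarse triangles. At vertices
  outside \<open>t'\<close> those of \<open>x\<close> vanish, so the scaled coordinates of
  \<open>p\<close> are integers of absolute value less than 1, hence 0. Therefore \<open>p\<close>
  is a grid point of \<open>t'\<close> too, close enough to \<open>x\<close> to be a vertex of the
  other cell.\<close>

lemma refine_conforming:
  assumes \<tau>: "\<tau> \<in> refine l \<D>" "\<tau>' \<in> refine l \<D>"
    and x: "x \<in> convex hull \<tau>" "x \<in> convex hull \<tau>'" and p: "p \<in> \<tau>" "0 < bary \<tau> x p"
  shows "p \<in> \<tau>'"
proof -
  obtain t n where t: "t \<in> \<D>" "\<tau> = cell l t n" "card \<tau> = 3" "\<not> affine_dependent \<tau>"
    using \<tau>(1) by (rule refine_cell)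
  obtain t' n' where t': "t' \<in> \<D>" "\<tau>' = cell l t' n'" "card \<tau>' = 3" "\<not> affine_dependent \<tau>'"
    using \<tau>(2) by (rule refine_cell)
  have it: "\<not> affine_dependent t" and it': "\<not> affine_dependent t'" using t(1) t'(1) triangulates_triangle by auto
  have fin: "finite \<tau>" "finite \<tau>'" using t(3) t'(3) by (auto intro: card_ge_0_finite)
  have sub: "\<tau> \<subseteq> convex hull t" "\<tau>' \<subseteq> convex hull t'" using t(2) t'(2) by (auto simp: cell_def)
  have xt: "x \<in> convex hull t" "x \<in> convex hull t'"
    using sub x by (meson convex_convex_hull hull_minimal subsetD)+
  have pt: "p \<in> convex hull t" using sub p(1) by auto
  note hp = convex_hull_bary[OF it pt]
  have eq: "bary t x = bary t' x" using triangulates_bary_eq[OF t(1) t'(1) xt] .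
  have d: "\<bar>l * bary t x v - l * bary t p v\<bar> < 1" for v
    by (rule cell_bary_dist[OF t(1,2) fin(1) t(4) x(1) p])
  have int: "l * bary t p v \<in> \<int>" for v
  proof (cases "v \<in> t")
    case True
    then show ?thesis using p(1) t(2) unfolding cell_def by fastforce
  qed (use hp(3) in auto)
  have out: "bary t p v = 0" if "v \<notin> t'" for v
  proof -
    have "bary t x v = 0" using convex_hull_bary(3)[OF it' xt(2) that] eq by simp
    with d[of v] have "\<bar>l * bary t p v\<bar> < 1" by simp
    moreover obtain k where k: "l * bary t p v = of_int k" using int[of v] by (auto elim: Ints_cases)
    ultimately have "k = 0" by linarith
    with k l show ?thesis by simp
  qed
  have fint: "finite t" "finite t'" using it it' aff_independent_finite by auto
  have s: "sum (bary t p) t' = 1" "(\<Sum>v\<in>t'. bary t p v *\<^sub>R v) = p"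
    using hp(1,2) out hp(3)
      sum.mono_neutral_cong[of t t' "bary t p" "bary t p"]
      sum.mono_neutral_cong[of t t' "\<lambda>v. bary t p v *\<^sub>R v" "\<lambda>v. bary t p v *\<^sub>R v"] fint by auto
  have eqp: "bary t' p = bary t p" by (rule bary_eqI[OF it' s out])
  have pt': "p \<in> convex hull t'"
    unfolding convex_hull_finite[OF fint(2)] using s hp(4) by blast
  show ?thesis
    by (rule cell_vertexI[OF t'(1,2) fin(2) t'(4) x(2) pt']) (use int d eq eqp in auto)
qed

lemma refine_cover: "(\<Union>\<tau>\<in>refine l \<D>. convex hull \<tau>) = closure \<Omega>"
proof -
  have cl: "(\<Union>t\<in>\<D>. convex hull t) = closure \<Omega>" using D by (simp add: triangulates_def)
  show ?thesis
    unfolding cl[symmetric]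
  proof (intro equalityI subsetI; elim UN_E)
    fix \<tau> x assume \<tau>: "\<tau> \<in> refine l \<D>" and x: "x \<in> convex hull \<tau>"
    obtain t n where t: "t \<in> \<D>" "\<tau> = cell l t n" using \<tau> by (rule refine_cell)
    then have "\<tau> \<subseteq> convex hull t" by (auto simp: cell_def)
    then have "convex hull \<tau> \<subseteq> convex hull t" by (rule hull_minimal) (rule convex_convex_hull)
    with x t(1) show "x \<in> (\<Union>t\<in>\<D>. convex hull t)" by blast
  next
    fix t x assume t: "t \<in> \<D>" and x: "x \<in> convex hull t"
    obtain a b c where abc: "t = {a, b, c}" using triangulates_triangle(1)[OF t] by (auto simp: card_3_iff)
    interpret triangle a b c using t triangulates_triangle unfolding abc by (intro triangleI) auto
    show "x \<in> (\<Union>\<tau>\<in>refine l \<D>. convex hull \<tau>)"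
      using ex_refine_hull[OF l] t x unfolding abc by blast
  qed
qed

end

section \<open>Conformity of the Powell--Sabin refinement\<close>

text \<open>The origin of \<open>T\<close> as a refinement is forgotten from here on. The assumption
  \<open>conforming\<close> is edge-to-edge meeting expressed by weights instead of faces.\<close>

locale ps_mesh = powell_sabin T vt ve q
  for T :: "point set set" and vt ve :: "point set \<Rightarrow> point" and q :: "point \<Rightarrow> nat \<Rightarrow> point" +
  assumes finite_T: "finite T"
    and card_T: "t \<in> T \<Longrightarrow> card t = 3"
    and indep_T: "t \<in> T \<Longrightarrow> \<not> affine_dependent t"
    and conforming: "\<lbrakk>t \<in> T; t' \<in> T; x \<in> convex hull t; x \<in> convex hull t'; p \<in> t; 0 < bary t x p\<rbrakk> \<Longrightarrow> p \<in> t'"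
    and splits: "splits" and admissible: "admissible"
begin

lemma finite_triangle: "t \<in> T \<Longrightarrow> finite t"
  using card_T by (metis card.infinite zero_neq_numeral)

text \<open>By \<open>conforming\<close> all weights off \<open>t'\<close> vanish, so the
  representation of \<open>x\<close> in \<open>t\<close> is also one in \<open>t'\<close>.\<close>

lemma bary_agree:
  assumes "t \<in> T" "t' \<in> T" "x \<in> convex hull t" "x \<in> convex hull t'"
  shows "bary t x = bary t' x"
proof -
  note h = convex_hull_bary[OF indep_T[OF assms(1)] assms(3)]
  have out: "bary t x v = 0" if "v \<notin> t'" for v
    using conforming[OF assms, of v] h(3)[of v] h(4)[of v] that by force
  have "sum (bary t x) t' = 1" "(\<Sum>v\<in>t'. bary t x v *\<^sub>R v) = x"
    using h(1,2) out h(3)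
      sum.mono_neutral_cong[of t t' "bary t x" "bary t x"]
      sum.mono_neutral_cong[of t t' "\<lambda>v. bary t x v *\<^sub>R v" "\<lambda>v. bary t x v *\<^sub>R v"]
      finite_triangle assms(1,2) by auto
  then show ?thesis using bary_eqI[OF indep_T[OF assms(2)], of "bary t x" x] out by simp
qed

section \<open>Edges and the triangles attached to them\<close>

lemma edges_ofD:
  assumes "t \<in> T" "e \<in> edges_of t"
  shows "e \<subseteq> t" "card e = 2" "finite e" "\<not> affine_dependent e" "e \<in> E" "t \<in> attached e"
proof -
  show e: "e \<subseteq> t" and "card e = 2" using assms by (auto simp: edges_of_def)
  then show "finite e" by (metis card.infinite zero_neq_numeral)
  show "\<not> affine_dependent e" using e indep_T assms affine_dependent_subset by blast
  show "e \<in> E" "t \<in> attached e" using assms e by (auto simp: E_def attached_def)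
qed

lemma attached_iff: "e \<in> E \<Longrightarrow> t \<in> attached e \<longleftrightarrow> t \<in> T \<and> e \<in> edges_of t"
  by (auto simp: attached_def E_def edges_of_def)

lemma E_attached: "e \<in> E \<Longrightarrow> \<exists>t. t \<in> attached e"
  by (auto simp: E_def edges_of_def attached_def)

lemma edgeD:
  assumes "e \<in> E"
  shows "card e = 2" "finite e" "\<not> affine_dependent e"
  using assms edges_ofD unfolding E_def by blast+

lemma other_vertex:
  assumes "e \<in> E" "v \<in> e"
  obtains w where "e = {v, w}" "v \<noteq> w"
  using edgeD(1)[OF assms(1)] assms(2) by (auto simp: card_2_iff)

lemma opposite_vertex:
  assumes "t \<in> T" "e \<in> edges_of t"
  obtains r where "t = insert r e" "r \<notin> e"
proof -
  have "card (t - e) = 1"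
    using edges_ofD[OF assms] card_T[OF assms(1)] by (simp add: card_Diff_subset)
  then obtain r where "t - e = {r}" by (auto simp: card_1_singleton_iff)
  then show ?thesis using that[of r] edges_ofD(1)[OF assms] by blast
qed

lemma affine_hull_triangle: "t \<in> T \<Longrightarrow> affine hull t = UNIV"
  by (rule affine_independent_span_eq) (use indep_T card_T in auto)

text \<open>Two triangles on the same side of a common edge overlap near the midpoint of that edge.\<close>

lemma same_side_eq:
  assumes t: "{p, p', r} \<in> T" "{p, p', r'} \<in> T"
    and r: "r \<notin> {p, p'}" and r': "r' = \<alpha> *\<^sub>R p + \<beta> *\<^sub>R p' + \<gamma> *\<^sub>R r" "\<alpha> + \<beta> + \<gamma> = 1" "0 < \<gamma>"
  shows "r = r'"
proof -
  interpret triangle p p' r using card_T indep_T t(1) by (intro triangleI) auto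
  \<comment> \<open>The point \<open>x\<close> below is the midpoint of the edge moved by the
    fraction \<open>\<epsilon>\<close> towards \<open>r'\<close>. With this \<open>M\<close> the
    products \<open>\<epsilon> * \<bar>\<alpha>\<bar>\<close> and
    \<open>\<epsilon> * \<bar>\<beta>\<bar>\<close> are at most 1/4, while
    \<open>(1 - \<epsilon>) / 2\<close> is at least 3/8, so the weights of \<open>x\<close> in the
    first triangle stay nonnegative.\<close>
  define M where "M = 1 + \<bar>\<alpha>\<bar> + \<bar>\<beta>\<bar>"
  define \<epsilon> where "\<epsilon> = 1 / (4 * M)"
  have M: "M \<ge> 1" by (simp add: M_def)
  then have \<epsilon>: "0 < \<epsilon>" "\<epsilon> \<le> 1/4" by (auto simp: \<epsilon>_def field_simps)
  have "\<epsilon> * \<bar>\<alpha>\<bar> \<le> 1/4" "\<epsilon> * \<bar>\<beta>\<bar> \<le> 1/4" using M by (auto simp: \<epsilon>_def M_def field_simps)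
  moreover have "\<bar>\<epsilon> * \<alpha>\<bar> = \<epsilon> * \<bar>\<alpha>\<bar>" "\<bar>\<epsilon> * \<beta>\<bar> = \<epsilon> * \<bar>\<beta>\<bar>" using \<epsilon>(1) by (auto simp: abs_mult)
  ultimately have "- (\<epsilon> * \<alpha>) \<le> 1/4" "- (\<epsilon> * \<beta>) \<le> 1/4" by linarith+
  then have pos: "0 \<le> (1 - \<epsilon>) / 2 + \<epsilon> * \<alpha>" "0 \<le> (1 - \<epsilon>) / 2 + \<epsilon> * \<beta>"
    using \<epsilon>(2) by (simp_all add: field_simps)
  define x where "x = ((1 - \<epsilon>) / 2) *\<^sub>R p + ((1 - \<epsilon>) / 2) *\<^sub>R p' + \<epsilon> *\<^sub>R r'"
  have x: "x = ((1 - \<epsilon>) / 2 + \<epsilon> * \<alpha>) *\<^sub>R p + ((1 - \<epsilon>) / 2 + \<epsilon> * \<beta>) *\<^sub>R p' + (\<epsilon> * \<gamma>) *\<^sub>R r"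
    unfolding x_def r'(1) by (simp add: algebra_simps)
  have sum: "((1 - \<epsilon>) / 2 + \<epsilon> * \<alpha>) + ((1 - \<epsilon>) / 2 + \<epsilon> * \<beta>) + \<epsilon> * \<gamma> = 1"
    using arg_cong[OF r'(2), of "\<lambda>z. \<epsilon> * z"] by (simp add: algebra_simps)
  have "x \<in> convex hull {p, p', r}"
    unfolding convex_hull_3 using x sum pos \<epsilon> r'(3)
    by (intro CollectI exI[of _ "(1 - \<epsilon>) / 2 + \<epsilon> * \<alpha>"] exI[of _ "(1 - \<epsilon>) / 2 + \<epsilon> * \<beta>"]
        exI[of _ "\<epsilon> * \<gamma>"]) auto
  moreover have "x \<in> convex hull {p, p', r'}"
    unfolding convex_hull_3 using \<epsilon>
    by (intro CollectI exI[of _ "(1 - \<epsilon>) / 2"] exI[of _ "\<epsilon>"]) (auto simp: x_def)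
  moreover have "0 < bary {p, p', r} x r"
    unfolding x bary_three[OF sum] using dist \<epsilon>(1) r'(3) by auto
  ultimately have "r \<in> {p, p', r'}" using conforming[OF t, of x r] by blast
  then show ?thesis using r by blast
qed

text \<open>\<open>\<gamma> = 0\<close> would put \<open>r'\<close> on the line through the edge,
  and \<open>\<gamma> > 0\<close> is the overlapping situation of
  \<open>same_side_eq\<close>.\<close>

lemma opposite_sides:
  assumes t: "{p, p', r} \<in> T" "{p, p', r'} \<in> T"
  obtains \<alpha> \<beta> \<gamma> where "r' = \<alpha> *\<^sub>R p + \<beta> *\<^sub>R p' + \<gamma> *\<^sub>R r" "\<alpha> + \<beta> + \<gamma> = 1" "r = r' \<or> \<gamma> < 0"
proof -
  interpret triangle p p' r using card_T indep_T t(1) by (intro triangleI) auto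
  interpret t': triangle p p' r' using card_T indep_T t(2) by (intro triangleI) auto
  have "r' \<in> affine hull {p, p', r}" using affine_hull_triangle[OF t(1)] by simp
  then obtain \<alpha> \<beta> \<gamma> where *: "\<alpha> + \<beta> + \<gamma> = 1" "r' = \<alpha> *\<^sub>R p + \<beta> *\<^sub>R p' + \<gamma> *\<^sub>R r"
    by (auto simp: affine_hull_3)
  have "\<gamma> \<noteq> 0"
  proof
    assume "\<gamma> = 0"
    then have "\<alpha> + \<beta> + (-1) = 0" "\<alpha> *\<^sub>R p + \<beta> *\<^sub>R p' + (-1) *\<^sub>R r' = 0" using * by auto
    from affine_independent_threeD(3)[OF t'.indep t'.dist this] show False by simp
  qed
  moreover have "r = r'" if "0 < \<gamma>" using same_side_eq[OF t _ *(2,1) that] dist by auto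
  ultimately show ?thesis using that[OF *(2,1)] by linarith
qed

lemma attached_at_most_two:
  assumes e: "e \<in> E" and t: "t1 \<in> attached e" "t2 \<in> attached e" "t3 \<in> attached e"
  shows "t1 = t2 \<or> t2 = t3 \<or> t1 = t3"
proof -
  obtain p p' where pq: "e = {p, p'}" using edgeD(1)[OF e] by (auto simp: card_2_iff)
  have ex: "\<exists>r. t = {p, p', r} \<and> r \<notin> {p, p'} \<and> t \<in> T" if "t \<in> attached e" for t
  proof -
    have t: "t \<in> T" "e \<in> edges_of t" using that attached_iff[OF e] by auto
    obtain r where "t = insert r e" "r \<notin> e" using opposite_vertex[OF t] .
    then show ?thesis using t(1) unfolding pq by (auto simp: insert_commute)
  qed
  obtain r1 r2 r3 where r: "t1 = {p, p', r1}" "t2 = {p, p', r2}" "t3 = {p, p', r3}"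
    "t1 \<in> T" "t2 \<in> T" "t3 \<in> T" "r1 \<notin> {p, p'}"
    using ex t by metis
  obtain \<alpha> \<beta> \<gamma> where 1: "r2 = \<alpha> *\<^sub>R p + \<beta> *\<^sub>R p' + \<gamma> *\<^sub>R r1" "\<alpha> + \<beta> + \<gamma> = 1" "r1 = r2 \<or> \<gamma> < 0"
    using opposite_sides[of p p' r1 r2] r by auto
  obtain \<alpha>' \<beta>' \<gamma>' where 2: "r3 = \<alpha>' *\<^sub>R p + \<beta>' *\<^sub>R p' + \<gamma>' *\<^sub>R r2" "\<alpha>' + \<beta>' + \<gamma>' = 1" "r2 = r3 \<or> \<gamma>' < 0"
    using opposite_sides[of p p' r2 r3] r by auto
  \<comment> \<open>Crossing the line of the edge twice returns to the first side: the weight of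
    \<open>r3\<close> at \<open>r1\<close> is the product of two negative numbers.\<close>
  have "r1 = r3" if "\<gamma> < 0" "\<gamma>' < 0"
  proof (rule same_side_eq)
    show "r3 = (\<alpha>' + \<gamma>' * \<alpha>) *\<^sub>R p + (\<beta>' + \<gamma>' * \<beta>) *\<^sub>R p' + (\<gamma>' * \<gamma>) *\<^sub>R r1"
      unfolding 2(1) 1(1) by (simp add: algebra_simps)
    have "(\<alpha>' + \<gamma>' * \<alpha>) + (\<beta>' + \<gamma>' * \<beta>) + \<gamma>' * \<gamma> = \<alpha>' + \<beta>' + \<gamma>' * (\<alpha> + \<beta> + \<gamma>)"
      by (simp add: algebra_simps)
    then show "(\<alpha>' + \<gamma>' * \<alpha>) + (\<beta>' + \<gamma>' * \<beta>) + \<gamma>' * \<gamma> = 1" using 1(2) 2(2) by simp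
    show "0 < \<gamma>' * \<gamma>" using that by (simp add: mult_neg_neg)
  qed (use r in auto)
  then show ?thesis using r(1-3) 1(3) 2(3) by blast
qed

text \<open>This justifies the definite description in \<open>other\<close> and makes
  \<open>other e\<close> an involution on the two triangles at an interior edge.\<close>

lemma attached_interior_edge:
  assumes e: "e \<in> E" "\<not> boundary_edge e" and t: "t \<in> attached e"
  obtains t' where "attached e = {t, t'}" "t \<noteq> t'" "other e t = t'" "other e t' = t"
proof -
  have "attached e \<noteq> {t}" using e by (auto simp: boundary_edge_def)
  with t obtain t' where t': "t' \<in> attached e" "t \<noteq> t'" by blast
  have eq: "attached e = {t, t'}"
  proof
    show "attached e \<subseteq> {t, t'}"
      using attached_at_most_two[OF e(1) t t'(1)] t'(2) by blast
  qed (use t t' in simp)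
  have "other e t = t'" "other e t' = t"
    unfolding other_def eq by (rule the_equality; use t'(2) in auto)+
  then show ?thesis using that eq t'(2) by blast
qed

section \<open>Weights of the split points\<close>

lemma vt_in_hull: "t \<in> T \<Longrightarrow> vt t \<in> convex hull t"
  using splits interior_subset unfolding splits_def by blast

lemma vt_pos: assumes "t \<in> T" "v \<in> t" shows "0 < bary t (vt t) v"
proof (rule bary_pos_rel_interior[OF indep_T[OF assms(1)] _ assms(2)])
  have "vt t \<in> interior (convex hull t)" using splits assms(1) by (simp add: splits_def)
  then show "vt t \<in> rel_interior (convex hull t)" using interior_subset_rel_interior by blast
qed

text \<open>All vertices of a triangle have positive weight at its split point, so
  \<open>conforming\<close> gives both inclusions.\<close>

lemma vt_inj: assumes "t \<in> T" "t' \<in> T" "vt t = vt t'" shows "t = t'"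
proof -
  have "t \<subseteq> t'" "t' \<subseteq> t"
    using conforming vt_in_hull vt_pos assms by (metis subsetI)+
  then show ?thesis by blast
qed

lemma ve_rel_interior:
  assumes "e \<in> E" shows "ve e \<in> rel_interior (convex hull e)"
proof (cases "boundary_edge e")
  case True
  then have "ve e = barycenter e" using splits assms by (auto simp: splits_def)
  moreover have "barycenter e \<in> rel_interior (convex hull e)"
    unfolding rel_interior_convex_hull_explicit[OF edgeD(3)[OF assms]]
    using edgeD(1)[OF assms]
    by (intro CollectI exI[of _ "\<lambda>_. 1/2"]) (auto simp: barycenter_def scaleR_sum_right inverse_eq_divide)
  ultimately show ?thesis by simp
next
  case False
  obtain t where t: "t \<in> attached e" using E_attached[OF assms] by blast
  obtain t' where "attached e = {t, t'}" "t \<noteq> t'" using attached_interior_edge[OF assms False t] by metis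
  then show ?thesis using splits assms unfolding splits_def by blast
qed

lemma lam_pos: "e \<in> E \<Longrightarrow> v \<in> e \<Longrightarrow> 0 < lam v e"
  unfolding lam_def using bary_pos_rel_interior ve_rel_interior edgeD(3) by blast

lemma ve_in_hull: "e \<in> E \<Longrightarrow> ve e \<in> convex hull e"
  using ve_rel_interior rel_interior_subset by blast

lemma
  assumes "e \<in> E"
  shows sum_lam: "(\<Sum>v\<in>e. lam v e) = 1"
    and lam_combination: "(\<Sum>v\<in>e. lam v e *\<^sub>R v) = ve e"
    and lam_outside: "v \<notin> e \<Longrightarrow> lam v e = 0"
    and lam_nonneg: "0 \<le> lam v e"
  using convex_hull_bary[OF edgeD(3) ve_in_hull] assms unfolding lam_def by blast+

lemma lam_less_1: assumes "e \<in> E" "v \<in> e" shows "lam v e < 1"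
proof -
  obtain w where w: "e = {v, w}" "v \<noteq> w" using other_vertex[OF assms] .
  then show ?thesis using sum_lam[OF assms(1)] lam_pos[OF assms(1), of w] by auto
qed

lemma lam_le_1: "e \<in> E \<Longrightarrow> lam v e \<le> 1"
  using lam_less_1[of e v] lam_outside[of e v] by (cases "v \<in> e") auto

section \<open>Representations of a point in small triangles\<close>

lemma smallD:
  assumes "(v, e, t) \<in> small"
  shows "t \<in> T" "e \<in> edges_of t" "v \<in> e" "e \<in> E" "v \<in> t" "e \<subseteq> t"
  using assms edges_ofD by (auto simp: small_def)

text \<open>For \<open>u1 + u2 + u3 = 1\<close> these are the barycentric coordinates, with respect
  to the whole triangle \<open>t\<close>, of the point with weights \<open>u1\<close>,
  \<open>u2\<close>, \<open>u3\<close> at the corners. Other sums occur when a linear relation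
  between the corners is tested.\<close>

fun coords :: "point \<times> point set \<times> point set \<Rightarrow> real \<Rightarrow> real \<Rightarrow> real \<Rightarrow> point \<Rightarrow> real" where
  "coords (v, e, t) u1 u2 u3 p = (if p = v then u1 else 0) + u2 * lam p e + u3 * bary t (vt t) p"

lemma coords_sum:
  assumes "(v, e, t) \<in> small"
  shows "(\<Sum>p\<in>t. coords (v, e, t) u1 u2 u3 p) = u1 + u2 + u3"
    and "(\<Sum>p\<in>t. coords (v, e, t) u1 u2 u3 p *\<^sub>R p) = u1 *\<^sub>R v + u2 *\<^sub>R ve e + u3 *\<^sub>R vt t"
proof -
  note s = smallD[OF assms]
  have fin: "finite t" using finite_triangle s by blast
  note h = convex_hull_bary[OF indep_T vt_in_hull, OF s(1) s(1)]
  have l: "(\<Sum>p\<in>t. lam p e) = 1" "(\<Sum>p\<in>t. lam p e *\<^sub>R p) = ve e"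
    using sum.mono_neutral_right[OF fin s(6), of "\<lambda>p. lam p e"]
      sum.mono_neutral_right[OF fin s(6), of "\<lambda>p. lam p e *\<^sub>R p"] sum_lam[OF s(4)] lam_combination[OF s(4)]
      lam_outside[OF s(4)] by auto
  show "(\<Sum>p\<in>t. coords (v, e, t) u1 u2 u3 p) = u1 + u2 + u3"
    using fin s(5) l(1) h(1) by (simp add: sum.distrib flip: sum_distrib_left)
  have "(if p = v then u1 else 0) *\<^sub>R p = (if p = v then u1 *\<^sub>R v else 0)" for p by simp
  then show "(\<Sum>p\<in>t. coords (v, e, t) u1 u2 u3 p *\<^sub>R p) = u1 *\<^sub>R v + u2 *\<^sub>R ve e + u3 *\<^sub>R vt t"
    using fin s(5) l(2) h(2)
    by (simp add: scaleR_add_left sum.distrib scaleR_scaleR[symmetric] del: scaleR_scaleR flip: scaleR_sum_right)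
qed

lemma coords_outside: "(v, e, t) \<in> small \<Longrightarrow> p \<notin> t \<Longrightarrow> coords (v, e, t) u1 u2 u3 p = 0"
  using smallD[of v e t] lam_outside[of e p] convex_hull_bary(3)[OF indep_T vt_in_hull, of t p] by auto

lemma bary_coords:
  assumes "(v, e, t) \<in> small" "u1 + u2 + u3 = 1"
  shows "bary t (u1 *\<^sub>R v + u2 *\<^sub>R ve e + u3 *\<^sub>R vt t) = coords (v, e, t) u1 u2 u3"
  by (rule bary_eqI) (use assms coords_sum coords_outside smallD indep_T in auto)

lemma in_hull_coords:
  assumes "(v, e, t) \<in> small" "u1 + u2 + u3 = 1" "0 \<le> u1" "0 \<le> u2" "0 \<le> u3"
  shows "u1 *\<^sub>R v + u2 *\<^sub>R ve e + u3 *\<^sub>R vt t \<in> convex hull t"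
proof -
  note s = smallD[OF assms(1)]
  have "v \<in> convex hull t" "ve e \<in> convex hull t" "vt t \<in> convex hull t"
    using s ve_in_hull[OF s(4)] vt_in_hull hull_mono[OF s(6)] by (auto intro: hull_inc)
  then have "convex hull {v, ve e, vt t} \<subseteq> convex hull t"
    by (intro hull_minimal convex_convex_hull) auto
  moreover have "u1 *\<^sub>R v + u2 *\<^sub>R ve e + u3 *\<^sub>R vt t \<in> convex hull {v, ve e, vt t}"
    unfolding convex_hull_3 using assms by blast
  ultimately show ?thesis by blast
qed

text \<open>At the vertex opposite to \<open>e\<close> only \<open>vt t\<close> has weight, so its
  coefficient in a relation is 0; at the second endpoint of \<open>e\<close> only
  \<open>ve e\<close> is then left.\<close>

lemma corners_independent:
  assumes "(v, e, t) \<in> small"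
  shows "v \<noteq> ve e" "v \<noteq> vt t" "ve e \<noteq> vt t" "\<not> affine_dependent {v, ve e, vt t}"
proof -
  note s = smallD[OF assms]
  have "\<forall>\<alpha> \<beta> \<gamma>. \<alpha> + \<beta> + \<gamma> = 0 \<longrightarrow> \<alpha> *\<^sub>R v + \<beta> *\<^sub>R ve e + \<gamma> *\<^sub>R vt t = 0
    \<longrightarrow> \<alpha> = 0 \<and> \<beta> = 0 \<and> \<gamma> = 0"
  proof (intro allI impI)
    fix \<alpha> \<beta> \<gamma> :: real
    assume "\<alpha> + \<beta> + \<gamma> = 0" "\<alpha> *\<^sub>R v + \<beta> *\<^sub>R ve e + \<gamma> *\<^sub>R vt t = 0"
    then have "sum (coords (v, e, t) \<alpha> \<beta> \<gamma>) t = 0" "(\<Sum>p\<in>t. coords (v, e, t) \<alpha> \<beta> \<gamma> p *\<^sub>R p) = 0"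
      using coords_sum[OF assms, of \<alpha> \<beta> \<gamma>] by auto
    then have z: "\<forall>p\<in>t. coords (v, e, t) \<alpha> \<beta> \<gamma> p = 0"
      using indep_T[OF s(1)] unfolding affine_dependent_explicit_finite[OF finite_triangle[OF s(1)]] by blast
    obtain r where r: "t = insert r e" "r \<notin> e" using opposite_vertex[OF s(1,2)] .
    obtain w where w: "e = {v, w}" "v \<noteq> w" using other_vertex[OF s(4,3)] .
    have "r \<noteq> v" using r s(3) by auto
    then have "\<gamma> * bary t (vt t) r = 0" using z r(1) lam_outside[OF s(4) r(2)] by auto
    then have \<gamma>: "\<gamma> = 0" using vt_pos[OF s(1), of r] r by auto
    then have "\<beta> * lam w e = 0" using z w r(1) by auto
    then have "\<beta> = 0" using lam_pos[OF s(4), of w] w by auto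
    then show "\<alpha> = 0 \<and> \<beta> = 0 \<and> \<gamma> = 0" using \<gamma> \<open>\<alpha> + \<beta> + \<gamma> = 0\<close> by simp
  qed
  then show "v \<noteq> ve e" "v \<noteq> vt t" "ve e \<noteq> vt t" "\<not> affine_dependent {v, ve e, vt t}"
    by (rule affine_independent_three)+
qed

text \<open>At the vertex opposite to \<open>e'\<close> the second representation consists of its
  \<open>u3'\<close> term alone, which gives the inequality; exchanging the roles later gives
  equality. For distinct triangles, a vertex of \<open>t\<close> outside \<open>t'\<close> has
  weight 0, although it would be at least a positive multiple of \<open>u3\<close>.\<close>

lemma small_conforming_split:
  assumes \<sigma>: "(v, e, t) \<in> small" and \<sigma>': "(v', e', t') \<in> small"
    and u: "0 \<le> u1" "0 \<le> u2" "0 \<le> u3" "u1 + u2 + u3 = 1"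
    and u': "0 \<le> u1'" "0 \<le> u2'" "0 \<le> u3'" "u1' + u2' + u3' = 1"
    and eq: "coords (v, e, t) u1 u2 u3 = coords (v', e', t') u1' u2' u3'"
  shows "u3 \<le> u3'" "t \<noteq> t' \<Longrightarrow> u3 = 0"
proof -
  note s = smallD[OF \<sigma>] and s' = smallD[OF \<sigma>']
  have ge: "u3 * bary t (vt t) p \<le> coords (v, e, t) u1 u2 u3 p" for p
    using u lam_nonneg[OF s(4), of p] by simp
  show d: "u3 = 0" if "t \<noteq> t'"
  proof -
    have "\<not> t \<subseteq> t'"
      using that card_subset_eq[OF finite_triangle[OF s'(1)], of t] card_T[OF s(1)] card_T[OF s'(1)] by auto
    then obtain p where p: "p \<in> t" "p \<notin> t'" by blast
    have "u3 * bary t (vt t) p \<le> 0"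
      using ge[of p] unfolding eq coords_outside[OF \<sigma>' p(2)] .
    then show ?thesis using vt_pos[OF s(1) p(1)] u(3) by (simp add: mult_le_0_iff)
  qed
  show "u3 \<le> u3'"
  proof (cases "t = t'")
    case True
    obtain r where r: "t' = insert r e'" "r \<notin> e'" using opposite_vertex[OF s'(1,2)] .
    have "r \<noteq> v'" using r s'(3) by auto
    then have "u3 * bary t (vt t) r \<le> u3' * bary t (vt t) r"
      using ge[of r] unfolding eq using lam_outside[OF s'(4) r(2)] True by auto
    then show ?thesis using vt_pos[OF s(1), of r] r True by simp
  qed (use d u' in auto)
qed

text \<open>Distinct edges have an endpoint of \<open>e\<close> off \<open>e'\<close>; there the
  right-hand side is 0, but \<open>u2 * lam p e\<close> is positive.\<close>

lemma small_conforming_edge: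
  assumes e: "e \<in> E" "v \<in> e" and e': "e' \<in> E" "v' \<in> e'"
    and u: "0 \<le> u1" "0 \<le> u2" and u': "0 \<le> u1'" "0 \<le> u2'"
    and eq: "\<And>p. (if p = v then u1 else 0) + u2 * lam p e = (if p = v' then u1' else 0) + u2' * lam p e'"
    and ne: "u2 \<noteq> 0"
  shows "e = e'"
proof (rule ccontr)
  assume "e \<noteq> e'"
  then obtain p where p: "p \<in> e" "p \<notin> e'"
    using edgeD(1,2)[OF e(1)] edgeD(1,2)[OF e'(1)] by (metis card_subset_eq subsetI)
  have "(if p = v then u1 else 0) + u2 * lam p e = 0"
    using eq[of p] p e'(2) lam_outside[OF e'(1) p(2)] by auto
  moreover have "0 < u2 * lam p e" using ne u(2) lam_pos[OF e(1) p(1)] by simp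
  ultimately show False using u(1) by (auto split: if_splits)
qed

lemma small_conforming:
  assumes \<sigma>: "(v, e, t) \<in> small" and \<sigma>': "(v', e', t') \<in> small"
    and u: "0 \<le> u1" "0 \<le> u2" "0 \<le> u3" "u1 + u2 + u3 = 1"
    and u': "0 \<le> u1'" "0 \<le> u2'" "0 \<le> u3'" "u1' + u2' + u3' = 1"
    and x: "u1 *\<^sub>R v + u2 *\<^sub>R ve e + u3 *\<^sub>R vt t = u1' *\<^sub>R v' + u2' *\<^sub>R ve e' + u3' *\<^sub>R vt t'"
  shows "u1 = u1'" "u2 = u2'" "u3 = u3'" "u1 = 0 \<or> v = v'" "u2 = 0 \<or> e = e'" "u3 = 0 \<or> t = t'"
proof -
  note s = smallD[OF \<sigma>] and s' = smallD[OF \<sigma>']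
  have eq: "coords (v, e, t) u1 u2 u3 = coords (v', e', t') u1' u2' u3'"
    using bary_agree[OF s(1) s'(1)] in_hull_coords[OF \<sigma> u(4,1-3)] in_hull_coords[OF \<sigma>' u'(4,1-3)]
    unfolding bary_coords[OF \<sigma> u(4), symmetric] bary_coords[OF \<sigma>' u'(4), symmetric] x by simp
  show 3: "u3 = u3'"
    using small_conforming_split(1)[OF \<sigma> \<sigma>' u u' eq] small_conforming_split(1)[OF \<sigma>' \<sigma> u' u eq[symmetric]] by simp
  show t: "u3 = 0 \<or> t = t'" using small_conforming_split(2)[OF \<sigma> \<sigma>' u u' eq] by blast
  \<comment> \<open>The terms of the split points of the triangles cancel: either
    \<open>t = t'\<close> with equal weights, or both weights are 0.\<close>
  have eq': "(if p = v then u1 else 0) + u2 * lam p e = (if p = v' then u1' else 0) + u2' * lam p e'" for p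
    using fun_cong[OF eq, of p] t 3 by auto
  have e: "u2 = 0 \<or> e = e'"
    using small_conforming_edge[OF s(4,3) s'(4,3) u(1,2) u'(1,2) eq'] by blast
  have e': "u2' = 0 \<or> e = e'"
    using small_conforming_edge[OF s'(4,3) s(4,3) u'(1,2) u(1,2) eq'[symmetric]] by blast
  have "u1 = u1' \<and> u2 = u2' \<and> (u1 = 0 \<or> v = v')"
  proof (cases "e = e'")
    case True
    show ?thesis
    proof (cases "v = v'")
      case v: True
      obtain w where w: "e = {v, w}" "v \<noteq> w" using other_vertex[OF s(4,3)] .
      have "u2 * lam w e = u2' * lam w e" using eq'[of w] w True v by auto
      then have "u2 = u2'" using lam_pos[OF s(4), of w] w by auto
      then show ?thesis using u(4) u'(4) 3 v by auto
    next
      case v: False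
      \<comment> \<open>The small triangles lie on different sides of \<open>ve e\<close>. Comparing
        at both endpoints gives \<open>u2 \<le> u2'\<close> and \<open>u2' \<le> u2\<close>, after
        which \<open>u1\<close> and \<open>u1'\<close> must be 0.\<close>
      have a: "u1 + u2 * lam v e = u2' * lam v e" using eq'[of v] v True by auto
      have b: "u2 * lam v' e = u1' + u2' * lam v' e" using eq'[of v'] v True by auto
      have lp: "0 < lam v e" "0 < lam v' e" using lam_pos s s' True by auto
      have "u2 * lam v e \<le> u2' * lam v e" "u2' * lam v' e \<le> u2 * lam v' e" using a b u u' by linarith+
      then have "u2 = u2'" using lp by simp
      then show ?thesis using a b by simp
    qed
  next
    case False
    then have z: "u2 = 0" "u2' = 0" using e e' by auto
    then have "u1 = u1'" using u(4) u'(4) 3 by simp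
    then show ?thesis using eq'[of v] z by (auto split: if_splits)
  qed
  then show "u1 = u1'" "u2 = u2'" "u1 = 0 \<or> v = v'" by auto
  show "u2 = 0 \<or> e = e'" by (rule e)
qed

section \<open>Single-valuedness of the spline\<close>

fun bb_poly :: "(point \<Rightarrow> nat \<Rightarrow> real) \<Rightarrow> (point \<times> point set \<times> point set \<Rightarrow> real) \<Rightarrow>
    point \<times> point set \<times> point set \<Rightarrow> real \<Rightarrow> real \<Rightarrow> real \<Rightarrow> real" where
  "bb_poly cv c (v, e, t) u1 u2 u3 =
     u1^3 * b_vv cv v v + 3 * u1^2 * u2 * b_vv cv v (ve e) + 3 * u1^2 * u3 * b_vv cv v (vt t)
       + 3 * u1 * u2^2 * b_vee cv c v e + 6 * u1 * u2 * u3 * b_vet cv c v e t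
       + 3 * u1 * u3^2 * b_vtt cv c v t
       + u2^3 * b_eee cv c e + 3 * u2^2 * u3 * b_eet cv c e t + 3 * u2 * u3^2 * b_ett cv c e t
       + u3^3 * b_ttt cv c t"

lemma bb_form_eq_poly:
  assumes "(v, e, t) \<in> small" "u1 + u2 + u3 = 1"
  shows "bb_form cv c (v, e, t) (u1 *\<^sub>R v + u2 *\<^sub>R ve e + u3 *\<^sub>R vt t) = bb_poly cv c (v, e, t) u1 u2 u3"
proof -
  note i = corners_independent[OF assms(1)]
  interpret triangle v "ve e" "vt t" using i by unfold_locales
  show ?thesis using i(1-3) by (simp add: bary_three[OF assms(2)] Let_def)
qed

text \<open>An ordinate depends only on the corners whose weights occur in its monomial. Corners of
  nonzero weight agree by \<open>small_conforming\<close>, and every monomial involving another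
  corner vanishes.\<close>

lemma bb_poly_agree:
  assumes "(v, e, t) \<in> small" "(v', e', t') \<in> small"
    and "0 \<le> u1" "0 \<le> u2" "0 \<le> u3" "u1 + u2 + u3 = 1"
    and "0 \<le> u1'" "0 \<le> u2'" "0 \<le> u3'" "u1' + u2' + u3' = 1"
    and "u1 *\<^sub>R v + u2 *\<^sub>R ve e + u3 *\<^sub>R vt t = u1' *\<^sub>R v' + u2' *\<^sub>R ve e' + u3' *\<^sub>R vt t'"
  shows "bb_poly cv c (v, e, t) u1 u2 u3 = bb_poly cv c (v', e', t') u1' u2' u3'"
proof -
  note small_conforming[OF assms]
  then show ?thesis
    by (cases "u1 = 0"; cases "u2 = 0"; cases "u3 = 0") simp_all
qed

lemma corners_hullE:
  assumes "x \<in> convex hull (corners (v, e, t))"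
  obtains u1 u2 u3 where "0 \<le> u1" "0 \<le> u2" "0 \<le> u3" "u1 + u2 + u3 = 1"
    "x = u1 *\<^sub>R v + u2 *\<^sub>R ve e + u3 *\<^sub>R vt t"
  using assms by (auto simp: convex_hull_3)

lemma spline_eq_poly:
  assumes \<sigma>: "(v, e, t) \<in> small" and u: "0 \<le> u1" "0 \<le> u2" "0 \<le> u3" "u1 + u2 + u3 = 1"
  shows "spline cv c (u1 *\<^sub>R v + u2 *\<^sub>R ve e + u3 *\<^sub>R vt t) = bb_poly cv c (v, e, t) u1 u2 u3"
proof -
  define x where "x = u1 *\<^sub>R v + u2 *\<^sub>R ve e + u3 *\<^sub>R vt t"
  have x: "x \<in> convex hull (corners (v, e, t))"
    unfolding x_def using u by (auto simp: convex_hull_3)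
  have uniq: "bb_form cv c \<sigma>' x = bb_poly cv c (v, e, t) u1 u2 u3"
    if \<sigma>': "\<sigma>' \<in> small" "x \<in> convex hull (corners \<sigma>')" for \<sigma>'
  proof -
    obtain v' e' t' where \<sigma>'_eq: "\<sigma>' = (v', e', t')" by (cases \<sigma>')
    obtain u1' u2' u3' where u': "0 \<le> u1'" "0 \<le> u2'" "0 \<le> u3'" "u1' + u2' + u3' = 1"
      "x = u1' *\<^sub>R v' + u2' *\<^sub>R ve e' + u3' *\<^sub>R vt t'"
      using \<sigma>'(2) unfolding \<sigma>'_eq by (rule corners_hullE)
    have \<sigma>'': "(v', e', t') \<in> small" using \<sigma>'(1) \<sigma>'_eq by simp
    show ?thesis
      unfolding \<sigma>'_eq u'(5) bb_form_eq_poly[OF \<sigma>'' u'(4)]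
      by (rule bb_poly_agree[OF \<sigma>'' \<sigma> u'(1-4) u]) (use u'(5) x_def in simp)
  qed
  have "(THE y. \<exists>\<sigma>\<in>small. x \<in> convex hull (corners \<sigma>) \<and> y = bb_form cv c \<sigma> x) = bb_poly cv c (v, e, t) u1 u2 u3"
    by (rule the_equality) (use \<sigma> x uniq[OF \<sigma> x] uniq in \<open>auto simp del: corners.simps bb_form.simps bb_poly.simps\<close>)
  moreover have "\<exists>\<sigma>\<in>small. x \<in> convex hull (corners \<sigma>)" using \<sigma> x by blast
  ultimately show ?thesis unfolding spline_def x_def[symmetric] by simp
qed

text \<open>The split point of \<open>t\<close> is given the largest weight that keeps the remaining
  coordinates \<open>z\<close> nonnegative. The vertex \<open>r\<close> attaining the minimum then
  has remainder 0, so \<open>z\<close> lives on the opposite edge, where the same procedure with the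
  weights \<open>lam\<close> determines \<open>u2\<close>; \<open>v\<close> is the endpoint with the
  larger quotient.\<close>

lemma small_cover:
  assumes t: "t \<in> T" and x: "x \<in> convex hull t"
  obtains v e u1 u2 u3 where "(v, e, t) \<in> small" "0 \<le> u1" "0 \<le> u2" "0 \<le> u3" "u1 + u2 + u3 = 1"
    "x = u1 *\<^sub>R v + u2 *\<^sub>R ve e + u3 *\<^sub>R vt t"
proof -
  define y where "y = bary t x"
  define a where "a = bary t (vt t)"
  have fin: "finite t" and ne: "t \<noteq> {}" using finite_triangle card_T[OF t] t by auto
  note hy = convex_hull_bary[OF indep_T[OF t] x, folded y_def]
  have apos: "0 < a p" if "p \<in> t" for p using vt_pos[OF t that] by (simp add: a_def)
  obtain r where r: "r \<in> t" "\<And>p. p \<in> t \<Longrightarrow> y r / a r \<le> y p / a p"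
    using ex_is_arg_min_if_finite[OF fin ne, of "\<lambda>p. y p / a p"]
    by (auto simp: is_arg_min_linorder)
  define u3 where "u3 = y r / a r"
  have u3: "0 \<le> u3" using hy(4) apos[OF r(1)] by (simp add: u3_def less_imp_le)
  define e where "e = t - {r}"
  have ce: "card e = 2" using card_T[OF t] r(1) fin by (simp add: e_def)
  then have e: "e \<in> edges_of t" by (auto simp: edges_of_def e_def)
  note eE = edges_ofD(5)[OF t e]
  define z where "z p = y p - u3 * a p" for p
  have z: "0 \<le> z p" if "p \<in> e" for p
    using r(2)[of p] apos[of p] that by (auto simp: z_def u3_def e_def field_simps)
  have zr: "z r = 0" using apos[OF r(1)] by (simp add: z_def u3_def)
  obtain v0 w0 where vw0: "e = {v0, w0}" "v0 \<noteq> w0" using ce by (auto simp: card_2_iff)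
  obtain v w where vw: "e = {v, w}" "v \<noteq> w" "z w / lam w e \<le> z v / lam v e"
    using that[of v0 w0] that[of w0 v0] vw0 by (metis insert_commute linear)
  have lp: "0 < lam v e" "0 < lam w e" using lam_pos[OF eE] vw(1) by auto
  define u2 where "u2 = z w / lam w e"
  define u1 where "u1 = z v - u2 * lam v e"
  have u2: "0 \<le> u2" using z[of w] lp vw(1) by (simp add: u2_def)
  have u1: "0 \<le> u1" using vw(3) lp by (simp add: u1_def u2_def field_simps)
  have \<sigma>: "(v, e, t) \<in> small" using t e vw(1) by (simp add: small_def)
  have yc: "y p = coords (v, e, t) u1 u2 u3 p" if "p \<in> t" for p
  proof -
    have "p = r \<or> p \<in> e" using that by (simp add: e_def)
    then consider "p = r" | "p = v" | "p = w" unfolding vw(1) by blast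
    then show ?thesis
    proof cases
      case 1
      then have "p \<noteq> v" "p \<notin> e" using vw(1) by (auto simp: e_def)
      then show ?thesis using 1 zr lam_outside[OF eE, of p] by (simp add: z_def a_def)
    next
      case 2
      then show ?thesis by (simp add: u1_def z_def a_def)
    next
      case 3
      then show ?thesis using vw(2) lp by (simp add: u2_def z_def a_def)
    qed
  qed
  have "u1 + u2 + u3 = 1" using coords_sum(1)[OF \<sigma>] hy(1) yc by (metis (no_types, lifting) sum.cong)
  moreover have "x = u1 *\<^sub>R v + u2 *\<^sub>R ve e + u3 *\<^sub>R vt t"
  proof -
    have "x = (\<Sum>p\<in>t. coords (v, e, t) u1 u2 u3 p *\<^sub>R p)"
      unfolding hy(2)[symmetric] by (rule sum.cong) (use yc in auto)
    then show ?thesis using coords_sum(2)[OF \<sigma>] by simp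
  qed
  ultimately show ?thesis using that[OF \<sigma> u1 u2 u3] by blast
qed

lemma spline_outside:
  assumes "x \<notin> (\<Union>t\<in>T. convex hull t)"
  shows "spline cv c x = 0"
proof -
  have "x \<notin> convex hull (corners \<sigma>)" if "\<sigma> \<in> small" for \<sigma>
  proof
    assume x: "x \<in> convex hull (corners \<sigma>)"
    obtain v e t where \<sigma>: "\<sigma> = (v, e, t)" by (cases \<sigma>)
    obtain u1 u2 u3 where "0 \<le> u1" "0 \<le> u2" "0 \<le> u3" "u1 + u2 + u3 = 1"
      "x = u1 *\<^sub>R v + u2 *\<^sub>R ve e + u3 *\<^sub>R vt t" using x unfolding \<sigma> by (rule corners_hullE)
    then have "x \<in> convex hull t" "t \<in> T" using in_hull_coords that smallD(1) unfolding \<sigma> by auto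
    then show False using assms by blast
  qed
  then show ?thesis by (simp add: spline_def)
qed

end

section \<open>Vanishing cubic forms and independent families\<close>

lemma cubic_form_zero:
  fixes a300 a210 a201 a120 a111 a102 a030 a021 a012 a003 :: real
  assumes "\<forall>u1 u2 u3. 0 \<le> u1 \<longrightarrow> 0 \<le> u2 \<longrightarrow> 0 \<le> u3 \<longrightarrow> u1 + u2 + u3 = 1 \<longrightarrow>
     u1^3 * a300 + 3 * u1^2 * u2 * a210 + 3 * u1^2 * u3 * a201 + 3 * u1 * u2^2 * a120
       + 6 * u1 * u2 * u3 * a111 + 3 * u1 * u3^2 * a102
       + u2^3 * a030 + 3 * u2^2 * u3 * a021 + 3 * u2 * u3^2 * a012 + u3^3 * a003 = 0"
  shows "a300 = 0" "a210 = 0" "a201 = 0" "a120 = 0" "a111 = 0"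
proof -
  \<comment> \<open>Evaluation at the ten domain points: corners first, then the two inner points of
    each side, where only two coefficients remain, in a system with rows (2, 1) and (1, 2), and at
    the barycenter only \<open>a111\<close> is left.\<close>
  note z = assms[rule_format]
  have v: "a300 = 0" "a030 = 0" "a003 = 0" using z[of 1 0 0] z[of 0 1 0] z[of 0 0 1] by simp_all
  have "2 * a210 + a120 = 0" using z[of "2/3" "1/3" 0] v by (simp add: power2_eq_square)
  moreover have "a210 + 2 * a120 = 0" using z[of "1/3" "2/3" 0] v by (simp add: power2_eq_square)
  ultimately have e1: "a210 = 0" "a120 = 0" by linarith+
  have "2 * a201 + a102 = 0" using z[of "2/3" 0 "1/3"] v by (simp add: power2_eq_square)
  moreover have "a201 + 2 * a102 = 0" using z[of "1/3" 0 "2/3"] v by (simp add: power2_eq_square)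
  ultimately have e2: "a201 = 0" "a102 = 0" by linarith+
  have "2 * a021 + a012 = 0" using z[of 0 "2/3" "1/3"] v by (simp add: power2_eq_square)
  moreover have "a021 + 2 * a012 = 0" using z[of 0 "1/3" "2/3"] v by (simp add: power2_eq_square)
  ultimately have e3: "a021 = 0" "a012 = 0" by linarith+
  show "a300 = 0" "a210 = 0" "a201 = 0" "a120 = 0" by (fact v e1 e2)+
  show "a111 = 0" using z[of "1/3" "1/3" "1/3"] v e1 e2 e3 by simp
qed

text \<open>Independence of the image set does not exclude repetitions in the family. A repetition
  \<open>f i = f j\<close> would be a vanishing combination with coefficients 1 and -1.\<close>

lemma finite_family_independent:
  fixes f :: "'i \<Rightarrow> point \<Rightarrow> real"
  assumes fin: "finite I"
    and z: "\<forall>d. (\<forall>x. (\<Sum>i\<in>I. d i * f i x) = 0) \<longrightarrow> (\<forall>i\<in>I. d i = 0)"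
  shows "inj_on f I" "real_fun.independent (f ` I)"
proof -
  show inj: "inj_on f I"
  proof (rule inj_onI, rule ccontr)
    fix i j assume ij: "i \<in> I" "j \<in> I" "f i = f j" "i \<noteq> j"
    define d where "d k = (if k = i then 1 else 0) - (if k = j then 1 else 0 :: real)" for k
    have "(\<Sum>k\<in>I. d k * f k x) = f i x - f j x" for x
    proof -
      have "d k * f k x = (if k = i then f i x else 0) - (if k = j then f j x else 0)" for k
        by (simp add: d_def)
      then show ?thesis using fin ij(1,2) by (simp add: sum_subtractf)
    qed
    then have "(\<Sum>k\<in>I. d k * f k x) = 0" for x using ij(3) by simp
    then have "d i = 0" using z ij(1) by blast
    then show False using ij(4) by (simp add: d_def)
  qed
  show "real_fun.independent (f ` I)"
  proof
    assume "real_fun.dependent (f ` I)"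
    then obtain u where u: "\<exists>g\<in>f ` I. u g \<noteq> 0" "(\<Sum>g\<in>f ` I. (\<lambda>x. u g * g x)) = 0"
      using real_fun.dependent_finite[of "f ` I"] fin by auto
    have sum_app: "(\<Sum>i\<in>J. h i) x = (\<Sum>i\<in>J. h i x)" for J and h :: "'i \<Rightarrow> point \<Rightarrow> real" and x
      by (induction J rule: infinite_finite_induct) auto
    have "(\<Sum>i\<in>I. u (f i) * f i x) = 0" for x
      using fun_cong[OF u(2), of x] unfolding sum.reindex[OF inj] by (simp add: sum_app)
    then have "\<forall>i\<in>I. u (f i) = 0" using spec[OF z, of "\<lambda>i. u (f i)"] by blast
    with u(1) show False by blast
  qed
qed

section \<open>Ordinates\<close>

context ps_mesh
begin

section \<open>Linearity in the coefficients\<close>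

lemma b_vv_linear:
  "b_vv (\<lambda>v r. a * cv v r + cv' v r) v w = a * b_vv cv v w + b_vv cv' v w"
  by (simp add: b_vv_def sum.distrib sum_distrib_left algebra_simps)

lemma b_vet_linear:
  "b_vet (\<lambda>v r. a * cv v r + cv' v r) (\<lambda>\<xi>. a * c \<xi> + c' \<xi>) v e t = a * b_vet cv c v e t + b_vet cv' c' v e t"
  unfolding b_vet_def b_vv_linear by (simp add: algebra_simps)

lemma b_vee_linear:
  "b_vee (\<lambda>v r. a * cv v r + cv' v r) (\<lambda>\<xi>. a * c \<xi> + c' \<xi>) v e = a * b_vee cv c v e + b_vee cv' c' v e"
  unfolding b_vee_def b_vv_linear b_vet_linear by (simp add: sum.distrib sum_distrib_left algebra_simps)

lemma b_vtt_linear: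
  "b_vtt (\<lambda>v r. a * cv v r + cv' v r) (\<lambda>\<xi>. a * c \<xi> + c' \<xi>) v t = a * b_vtt cv c v t + b_vtt cv' c' v t"
  unfolding b_vtt_def b_vv_linear by (simp add: sum.distrib sum_distrib_left algebra_simps)

lemma b_e_linear:
  "b_eee (\<lambda>v r. a * cv v r + cv' v r) (\<lambda>\<xi>. a * c \<xi> + c' \<xi>) e = a * b_eee cv c e + b_eee cv' c' e"
  "b_eet (\<lambda>v r. a * cv v r + cv' v r) (\<lambda>\<xi>. a * c \<xi> + c' \<xi>) e t = a * b_eet cv c e t + b_eet cv' c' e t"
  "b_ett (\<lambda>v r. a * cv v r + cv' v r) (\<lambda>\<xi>. a * c \<xi> + c' \<xi>) e t = a * b_ett cv c e t + b_ett cv' c' e t"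
  "b_ttt (\<lambda>v r. a * cv v r + cv' v r) (\<lambda>\<xi>. a * c \<xi> + c' \<xi>) t = a * b_ttt cv c t + b_ttt cv' c' t"
  unfolding b_eee_def b_eet_def b_ett_def b_ttt_def b_vee_linear b_vet_linear b_vtt_linear
  by (simp_all add: sum.distrib sum_distrib_left algebra_simps)

lemma bb_poly_linear:
  "bb_poly (\<lambda>v r. a * cv v r + cv' v r) (\<lambda>\<xi>. a * c \<xi> + c' \<xi>) \<sigma> u1 u2 u3 =
    a * bb_poly cv c \<sigma> u1 u2 u3 + bb_poly cv' c' \<sigma> u1 u2 u3"
proof (cases \<sigma>)
  case (fields v e t)
  show ?thesis
    unfolding fields bb_poly.simps b_vv_linear b_vet_linear b_vee_linear b_vtt_linear b_e_linear
    by (simp add: algebra_simps)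
qed

text \<open>The small triangles do not depend on the coefficients, so one representation of
  \<open>x\<close> serves all three splines. The form \<open>a * c \<xi> + c' \<xi>\<close> is the
  induction step of \<open>spline_sum\<close>.\<close>

lemma spline_linear:
  "spline (\<lambda>v r. a * cv v r + cv' v r) (\<lambda>\<xi>. a * c \<xi> + c' \<xi>) x = a * spline cv c x + spline cv' c' x"
proof (cases "x \<in> (\<Union>t\<in>T. convex hull t)")
  case True
  then obtain t where t: "t \<in> T" "x \<in> convex hull t" by blast
  obtain v e u1 u2 u3 where \<sigma>: "(v, e, t) \<in> small" "0 \<le> u1" "0 \<le> u2" "0 \<le> u3" "u1 + u2 + u3 = 1"
    "x = u1 *\<^sub>R v + u2 *\<^sub>R ve e + u3 *\<^sub>R vt t" using small_cover[OF t] .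
  show ?thesis unfolding \<sigma>(6) spline_eq_poly[OF \<sigma>(1-5)] by (rule bb_poly_linear)
qed (simp add: spline_outside)

lemma spline_zero: "spline (\<lambda>_ _. 0) (\<lambda>_. 0) x = 0"
  using spline_linear[of "-1" "\<lambda>_ _. 0" "\<lambda>_ _. 0" "\<lambda>_. 0" "\<lambda>_. 0" x] by simp

lemma spline_sum:
  "(\<Sum>i\<in>I. d i * spline (cv i) (c i) x) =
    spline (\<lambda>v r. \<Sum>i\<in>I. d i * cv i v r) (\<lambda>\<xi>. \<Sum>i\<in>I. d i * c i \<xi>) x"
  by (induction I rule: infinite_finite_induct) (simp_all add: spline_zero spline_linear)

section \<open>Dependence on nearby coefficients only\<close>

lemma \<Xi>1_iff: "(e, \<tau>) \<in> \<Xi>1 \<longleftrightarrow> e \<in> E \<and> (\<tau> \<in> attached e \<or> \<tau> = {} \<and> boundary_edge e)"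
  by (simp add: \<Xi>1_def)

lemma pair_edge: "t \<in> T \<Longrightarrow> v \<in> t \<Longrightarrow> w \<in> t - {v} \<Longrightarrow> {v, w} \<in> edges_of t"
  by (auto simp: edges_of_def)

text \<open>At an interior edge \<open>b_vee\<close> draws on the coefficients of both attached
  triangles, so the hypothesis on \<open>c\<close> has to range over every \<open>\<tau>\<close> at
  an edge of \<open>t\<close> and not just over \<open>t\<close> itself.\<close>

lemma bb_poly_cong:
  assumes \<sigma>: "(v, e, t) \<in> small"
    and cv: "\<And>v r. v \<in> t \<Longrightarrow> r \<in> {1..3} \<Longrightarrow> cv v r = cv' v r"
    and c: "\<And>v e \<tau>. v \<in> e \<Longrightarrow> e \<in> edges_of t \<Longrightarrow> (e, \<tau>) \<in> \<Xi>1 \<Longrightarrow> c (v, e, \<tau>) = c' (v, e, \<tau>)"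
  shows "bb_poly cv c (v, e, t) u1 u2 u3 = bb_poly cv' c' (v, e, t) u1 u2 u3"
proof -
  note s = smallD[OF \<sigma>]
  have vv: "b_vv cv v w = b_vv cv' v w" if "v \<in> t" for v w
    unfolding b_vv_def using cv[OF that] by (intro sum.cong) auto
  have vet: "b_vet cv c v e t' = b_vet cv' c' v e t'" if "v \<in> e" "t' \<in> attached e" "e \<in> edges_of t" for v e t'
    using vv[of v] c[of v e t'] that edges_ofD[OF s(1) that(3)] by (auto simp: b_vet_def \<Xi>1_iff)
  have vee: "b_vee cv c v e = b_vee cv' c' v e" if "v \<in> e" "e \<in> edges_of t" for v e
    using vv[of v] c[of v e "{}"] vet[OF that(1) _ that(2)] that edges_ofD[OF s(1) that(2)]
    by (auto simp: b_vee_def \<Xi>1_iff intro!: sum.cong)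
  have vtt: "b_vtt cv c v t = b_vtt cv' c' v t" if "v \<in> t" for v
  proof -
    have "c (v, {v, w}, t) = c' (v, {v, w}, t)" if w: "w \<in> t - {v}" for w
      using pair_edge[OF s(1) \<open>v \<in> t\<close> w] edges_ofD[OF s(1)] by (intro c) (auto simp: \<Xi>1_iff)
    then have "(\<Sum>w\<in>t - {v}. bary t (vt t) w * c (v, {v, w}, t)) =
      (\<Sum>w\<in>t - {v}. bary t (vt t) w * c' (v, {v, w}, t))"
      by (intro sum.cong) auto
    then show ?thesis using vv[OF that] by (simp add: b_vtt_def)
  qed
  have e: "v \<in> t" if "v \<in> e" for v using that s by blast
  have at: "t \<in> attached e" using edges_ofD[OF s(1,2)] by blast
  show ?thesis
    using vv[OF s(5)] vet[OF s(3) at s(2)] vee[OF s(3,2)] vtt[OF s(5)] vet[OF _ at s(2)] vee[OF _ s(2)] vtt e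
    by (simp add: b_eee_def b_eet_def b_ett_def b_ttt_def cong: sum.cong)
qed

lemma spline_cong_on:
  assumes "t \<in> T" "x \<in> convex hull t"
    and "\<And>v r. v \<in> t \<Longrightarrow> r \<in> {1..3} \<Longrightarrow> cv v r = cv' v r"
    and "\<And>v e \<tau>. v \<in> e \<Longrightarrow> e \<in> edges_of t \<Longrightarrow> (e, \<tau>) \<in> \<Xi>1 \<Longrightarrow> c (v, e, \<tau>) = c' (v, e, \<tau>)"
  shows "spline cv c x = spline cv' c' x"
proof -
  obtain v e u1 u2 u3 where \<sigma>: "(v, e, t) \<in> small" "0 \<le> u1" "0 \<le> u2" "0 \<le> u3" "u1 + u2 + u3 = 1"
    "x = u1 *\<^sub>R v + u2 *\<^sub>R ve e + u3 *\<^sub>R vt t" using small_cover[OF assms(1,2)] .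
  show ?thesis unfolding \<sigma>(6) spline_eq_poly[OF \<sigma>(1-5)] using \<sigma>(1) assms(3,4) by (rule bb_poly_cong)
qed

lemma spline_cong:
  assumes "\<And>v r. v \<in> V \<Longrightarrow> r \<in> {1..3} \<Longrightarrow> cv v r = cv' v r"
    and "\<And>v e \<tau>. v \<in> e \<Longrightarrow> (e, \<tau>) \<in> \<Xi>1 \<Longrightarrow> c (v, e, \<tau>) = c' (v, e, \<tau>)"
  shows "spline cv c x = spline cv' c' x"
proof (cases "x \<in> (\<Union>t\<in>T. convex hull t)")
  case True
  then obtain t where t: "t \<in> T" "x \<in> convex hull t" by blast
  show ?thesis by (rule spline_cong_on[OF t]) (use assms t(1) in \<open>auto simp: V_def\<close>)
qed (simp add: spline_outside)

section \<open>Constant and nonnegative coefficients\<close>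

lemma Q_independent:
  assumes "v \<in> V"
  shows "q v 1 \<noteq> q v 2" "q v 1 \<noteq> q v 3" "q v 2 \<noteq> q v 3" "\<not> affine_dependent (Q v)"
proof -
  have "\<not> collinear {q v 1, q v 2, q v 3}" using admissible assms by (auto simp: admissible_def Q_def)
  then show "q v 1 \<noteq> q v 2" "q v 1 \<noteq> q v 3" "q v 2 \<noteq> q v 3" "\<not> affine_dependent (Q v)"
    by (auto simp: collinear_3_eq_affine_dependent Q_def)
qed

lemma Q_hull:
  assumes "(v, e, t) \<in> small"
  shows "(2/3) *\<^sub>R v + (1/3) *\<^sub>R v \<in> convex hull (Q v)" "(2/3) *\<^sub>R v + (1/3) *\<^sub>R ve e \<in> convex hull (Q v)"
    "(2/3) *\<^sub>R v + (1/3) *\<^sub>R vt t \<in> convex hull (Q v)"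
proof -
  note s = smallD[OF assms]
  have v: "v \<in> V" using s by (auto simp: V_def)
  have "(2/3) *\<^sub>R v + (1/3) *\<^sub>R v = v" by (simp flip: scaleR_add_left)
  then show "(2/3) *\<^sub>R v + (1/3) *\<^sub>R v \<in> convex hull (Q v)" "(2/3) *\<^sub>R v + (1/3) *\<^sub>R ve e \<in> convex hull (Q v)"
    "(2/3) *\<^sub>R v + (1/3) *\<^sub>R vt t \<in> convex hull (Q v)"
    using admissible v s unfolding admissible_def by auto
qed

lemma sum_three: "(\<Sum>r=1..3::nat. f r) = f 1 + f 2 + f 3"
  by (simp add: numeral_eq_Suc algebra_simps)

lemma b_vv_const:
  assumes "v \<in> V" "(2/3) *\<^sub>R v + (1/3) *\<^sub>R w \<in> convex hull (Q v)"
  shows "b_vv (\<lambda>_ _. 1) v w = 1"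
  using convex_hull_bary(1)[OF Q_independent(4)[OF assms(1)] assms(2)] Q_independent(1-3)[OF assms(1)]
  unfolding b_vv_def sum_three Q_def by (simp add: add.assoc)

lemma b_vv_nonneg:
  assumes "v \<in> V" "(2/3) *\<^sub>R v + (1/3) *\<^sub>R w \<in> convex hull (Q v)" "\<And>v r. 0 \<le> cv v r"
  shows "0 \<le> b_vv cv v w"
  unfolding b_vv_def
  by (intro sum_nonneg mult_nonneg_nonneg convex_hull_bary(4)[OF Q_independent(4)] assms)

text \<open>The coordinates belong to the set of the two split points, the sum runs over the
  triangles; \<open>vt_inj\<close> identifies the two index sets.\<close>

lemma split_weights:
  assumes "e \<in> E" "\<not> boundary_edge e"
  shows "(\<Sum>t\<in>attached e. bary (vt ` attached e) (ve e) (vt t)) = 1"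
    and "0 \<le> bary (vt ` attached e) (ve e) p"
proof -
  obtain t where t: "t \<in> attached e" using E_attached[OF assms(1)] by blast
  obtain t' where t': "attached e = {t, t'}" "t \<noteq> t'" using attached_interior_edge[OF assms t] by metis
  have "ve e \<in> closed_segment (vt t) (vt t')"
    using splits assms(1) t' unfolding splits_def by blast
  then have h: "ve e \<in> convex hull (vt ` attached e)" by (simp add: t'(1) segment_convex_hull)
  have i: "\<not> affine_dependent (vt ` attached e)" by (simp add: t'(1))
  have inj: "inj_on vt (attached e)" by (intro inj_onI vt_inj) (auto simp: attached_def)
  show "(\<Sum>t\<in>attached e. bary (vt ` attached e) (ve e) (vt t)) = 1"
    using convex_hull_bary(1)[OF i h] by (simp add: sum.reindex[OF inj])
  show "0 \<le> bary (vt ` attached e) (ve e) p" by (rule convex_hull_bary(4)[OF i h])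
qed

lemma ordinates_const:
  assumes \<sigma>: "(v, e, t) \<in> small"
  shows "b_vv (\<lambda>_ _. 1) v v = 1" "b_vv (\<lambda>_ _. 1) v (ve e) = 1" "b_vv (\<lambda>_ _. 1) v (vt t) = 1"
    "b_vet (\<lambda>_ _. 1) (\<lambda>_. 1) v e t = 1" "b_vee (\<lambda>_ _. 1) (\<lambda>_. 1) v e = 1" "b_vtt (\<lambda>_ _. 1) (\<lambda>_. 1) v t = 1"
proof -
  note s = smallD[OF \<sigma>]
  have v: "v \<in> V" using s by (auto simp: V_def)
  show vv: "b_vv (\<lambda>_ _. 1) v v = 1" "b_vv (\<lambda>_ _. 1) v (ve e) = 1" "b_vv (\<lambda>_ _. 1) v (vt t) = 1"
    by (rule b_vv_const[OF v]; rule Q_hull[OF \<sigma>])+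
  show "b_vet (\<lambda>_ _. 1) (\<lambda>_. 1) v e t = 1" by (simp add: b_vet_def vv)
  \<comment> \<open>\<open>b_vee\<close> averages over both triangles at \<open>e\<close>, so the
    value is needed beyond \<open>t\<close> as well.\<close>
  have vet: "b_vet (\<lambda>_ _. 1) (\<lambda>_. 1) v e t' = 1" if "t' \<in> attached e" for t'
  proof -
    have "(v, e, t') \<in> small" using that s attached_iff by (auto simp: small_def)
    then show ?thesis using b_vv_const[OF v Q_hull(3)] by (simp add: b_vet_def)
  qed
  show "b_vee (\<lambda>_ _. 1) (\<lambda>_. 1) v e = 1"
    using split_weights(1)[OF s(4)] vv vet by (simp add: b_vee_def cong: sum.cong)
  have "bary t (vt t) v + (\<Sum>w\<in>t - {v}. bary t (vt t) w) = 1"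
    using convex_hull_bary(1)[OF indep_T vt_in_hull, OF s(1) s(1)] s(5) finite_triangle[OF s(1)]
    by (simp add: sum.remove)
  then show "b_vtt (\<lambda>_ _. 1) (\<lambda>_. 1) v t = 1" by (simp add: b_vtt_def vv)
qed

lemma bb_poly_const:
  assumes \<sigma>: "(v, e, t) \<in> small" and u: "u1 + u2 + u3 = 1"
  shows "bb_poly (\<lambda>_ _. 1) (\<lambda>_. 1) (v, e, t) u1 u2 u3 = 1"
proof -
  note s = smallD[OF \<sigma>]
  have e: "b_eee (\<lambda>_ _. 1) (\<lambda>_. 1) e = 1" "b_eet (\<lambda>_ _. 1) (\<lambda>_. 1) e t = 1" "b_ett (\<lambda>_ _. 1) (\<lambda>_. 1) e t = 1"
    using ordinates_const[of _ e t] sum_lam[OF s(4)] s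
    by (simp_all add: b_eee_def b_eet_def b_ett_def small_def cong: sum.cong)
  have "b_vtt (\<lambda>_ _. 1) (\<lambda>_. 1) w t = 1" if w: "w \<in> t" for w
  proof -
    have "card (t - {w}) = 2" using card_T[OF s(1)] w finite_triangle[OF s(1)] by simp
    then obtain w' where "w' \<in> t - {w}" by (metis card.empty ex_in_conv zero_neq_numeral)
    then have "(w, {w, w'}, t) \<in> small" using pair_edge[OF s(1) w] s(1) by (auto simp: small_def)
    then show ?thesis by (rule ordinates_const)
  qed
  then have "b_ttt (\<lambda>_ _. 1) (\<lambda>_. 1) t = 1"
    using convex_hull_bary(1)[OF indep_T vt_in_hull, OF s(1) s(1)] by (simp add: b_ttt_def cong: sum.cong)
  then have "bb_poly (\<lambda>_ _. 1) (\<lambda>_. 1) (v, e, t) u1 u2 u3 = (u1 + u2 + u3)^3"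
    using ordinates_const[OF \<sigma>] e by (simp add: power3_eq_cube power2_eq_square algebra_simps)
  then show ?thesis using u by simp
qed

lemma ordinates_nonneg:
  assumes \<sigma>: "(v, e, t) \<in> small" and cv: "\<And>v r. 0 \<le> cv v r" and c: "\<And>\<xi>. 0 \<le> c \<xi>"
  shows "0 \<le> b_vv cv v v" "0 \<le> b_vv cv v (ve e)" "0 \<le> b_vv cv v (vt t)"
    "0 \<le> b_vet cv c v e t" "0 \<le> b_vee cv c v e" "0 \<le> b_vtt cv c v t"
proof -
  note s = smallD[OF \<sigma>]
  have v: "v \<in> V" using s by (auto simp: V_def)
  show vv: "0 \<le> b_vv cv v v" "0 \<le> b_vv cv v (ve e)" "0 \<le> b_vv cv v (vt t)"
    by (rule b_vv_nonneg[OF v _ cv]; rule Q_hull[OF \<sigma>])+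
  note l = lam_nonneg[OF s(4), of v] lam_le_1[OF s(4), of v]
  have vet: "0 \<le> b_vet cv c v e t'" if "t' \<in> attached e" for t'
  proof -
    have "(v, e, t') \<in> small" using that s attached_iff by (auto simp: small_def)
    then have "0 \<le> b_vv cv v (vt t')" by (intro b_vv_nonneg[OF v _ cv] Q_hull(3))
    then show ?thesis using l c by (simp add: b_vet_def)
  qed
  show "0 \<le> b_vet cv c v e t" using vet edges_ofD[OF s(1,2)] by blast
  show "0 \<le> b_vee cv c v e"
    using split_weights(2)[OF s(4)] vv vet l c by (auto simp: b_vee_def intro!: sum_nonneg)
  show "0 \<le> b_vtt cv c v t"
    using convex_hull_bary(4)[OF indep_T vt_in_hull, OF s(1) s(1)] vv c
    by (auto simp: b_vtt_def intro!: sum_nonneg add_nonneg_nonneg)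
qed

lemma spline_nonneg:
  assumes cv: "\<And>v r. 0 \<le> cv v r" and c: "\<And>\<xi>. 0 \<le> c \<xi>"
  shows "0 \<le> spline cv c x"
proof (cases "x \<in> (\<Union>t\<in>T. convex hull t)")
  case True
  then obtain t where t: "t \<in> T" "x \<in> convex hull t" by blast
  obtain v e u1 u2 u3 where \<sigma>: "(v, e, t) \<in> small" and u: "0 \<le> u1" "0 \<le> u2" "0 \<le> u3" "u1 + u2 + u3 = 1"
    and x: "x = u1 *\<^sub>R v + u2 *\<^sub>R ve e + u3 *\<^sub>R vt t" using small_cover[OF t] .
  note s = smallD[OF \<sigma>]
  note o = ordinates_nonneg[where cv = cv and c = c, OF _ cv c]
  have e: "0 \<le> b_eee cv c e" "0 \<le> b_eet cv c e t" "0 \<le> b_ett cv c e t"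
    using o[of _ e t] lam_nonneg[OF s(4)] s
    by (auto simp: b_eee_def b_eet_def b_ett_def small_def intro!: sum_nonneg mult_nonneg_nonneg)
  have "0 \<le> b_vtt cv c w t" if w: "w \<in> t" for w
  proof -
    have "card (t - {w}) = 2" using card_T[OF s(1)] w finite_triangle[OF s(1)] by simp
    then obtain w' where "w' \<in> t - {w}" by (metis card.empty ex_in_conv zero_neq_numeral)
    then have "(w, {w, w'}, t) \<in> small" using pair_edge[OF s(1) w] s(1) by (auto simp: small_def)
    then show ?thesis by (rule o)
  qed
  then have "0 \<le> b_ttt cv c t"
    using convex_hull_bary(4)[OF indep_T vt_in_hull, OF s(1) s(1)]
    by (auto simp: b_ttt_def intro!: sum_nonneg mult_nonneg_nonneg)
  then show ?thesis
    unfolding x spline_eq_poly[OF \<sigma> u] bb_poly.simps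
    by (intro add_nonneg_nonneg mult_nonneg_nonneg zero_le_power o[OF \<sigma>] e u) simp_all
qed (simp add: spline_outside)

section \<open>Recovery of the coefficients from the function\<close>

lemma spline_zero_ordinates:
  assumes z: "\<And>x. spline cv c x = 0" and \<sigma>: "(v, e, t) \<in> small"
  shows "b_vv cv v v = 0" "b_vv cv v (ve e) = 0" "b_vv cv v (vt t) = 0"
    "b_vee cv c v e = 0" "b_vet cv c v e t = 0"
proof -
  have "\<forall>u1 u2 u3. 0 \<le> u1 \<longrightarrow> 0 \<le> u2 \<longrightarrow> 0 \<le> u3 \<longrightarrow> u1 + u2 + u3 = 1 \<longrightarrow>
    bb_poly cv c (v, e, t) u1 u2 u3 = 0"
    using spline_eq_poly[OF \<sigma>, of _ _ _ cv c] z by metis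
  note * = cubic_form_zero[OF this[unfolded bb_poly.simps]]
  show "b_vv cv v v = 0" "b_vv cv v (ve e) = 0" "b_vv cv v (vt t) = 0"
    "b_vee cv c v e = 0" "b_vet cv c v e t = 0" by (fact *)+
qed

lemma b_vv_zero_coefficients:
  assumes \<sigma>: "(v, e, t) \<in> small" and z: "b_vv cv v v = 0" "b_vv cv v (ve e) = 0" "b_vv cv v (vt t) = 0"
    and r: "r \<in> {1..3}"
  shows "cv v r = 0"
proof -
  note s = smallD[OF \<sigma>]
  have v: "v \<in> V" using s by (auto simp: V_def)
  note i = Q_independent[OF v]
  \<comment> \<open>These are the corners of the small triangle contracted towards \<open>v\<close>
    by the factor 1/3, so a relation between them is a relation between the corners.\<close>
  define a b d where "a = (2/3) *\<^sub>R v + (1/3) *\<^sub>R v" and "b = (2/3) *\<^sub>R v + (1/3) *\<^sub>R ve e"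
    and "d = (2/3) *\<^sub>R v + (1/3) *\<^sub>R vt t"
  have "\<forall>\<alpha> \<beta> \<gamma>. \<alpha> + \<beta> + \<gamma> = 0 \<longrightarrow> \<alpha> *\<^sub>R a + \<beta> *\<^sub>R b + \<gamma> *\<^sub>R d = 0
    \<longrightarrow> \<alpha> = 0 \<and> \<beta> = 0 \<and> \<gamma> = 0"
  proof (intro allI impI)
    fix \<alpha> \<beta> \<gamma> :: real
    assume sum: "\<alpha> + \<beta> + \<gamma> = 0" and "\<alpha> *\<^sub>R a + \<beta> *\<^sub>R b + \<gamma> *\<^sub>R d = 0"
    moreover have "\<alpha> *\<^sub>R a + \<beta> *\<^sub>R b + \<gamma> *\<^sub>R d =
      (\<alpha> + 2/3 * \<beta> + 2/3 * \<gamma>) *\<^sub>R v + (\<beta> / 3) *\<^sub>R ve e + (\<gamma> / 3) *\<^sub>R vt t"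
      unfolding a_def b_def d_def by (simp add: scaleR_add_right flip: scaleR_add_left)
    ultimately have c0: "(\<alpha> + 2/3 * \<beta> + 2/3 * \<gamma>) *\<^sub>R v + (\<beta> / 3) *\<^sub>R ve e + (\<gamma> / 3) *\<^sub>R vt t = 0"
      by simp
    have "(\<alpha> + 2/3 * \<beta> + 2/3 * \<gamma>) + (\<beta> / 3) + (\<gamma> / 3) = 0" using sum by simp
    from affine_independent_threeD[OF corners_independent(4,1,2,3)[OF \<sigma>] this c0] sum
    show "\<alpha> = 0 \<and> \<beta> = 0 \<and> \<gamma> = 0" by simp
  qed
  note ind = affine_independent_three[OF this]
  have fin: "finite {a, b, d}" by simp
  have "affine hull {a, b, d} = UNIV"
    by (rule affine_independent_span_eq) (use ind in auto)
  then have "q v r \<in> affine hull {a, b, d}" by simp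
  then obtain w where w: "sum w {a, b, d} = 1" "(\<Sum>p\<in>{a, b, d}. w p *\<^sub>R p) = q v r"
    unfolding affine_hull_finite[OF fin] by blast
  have sub: "{a, b, d} \<subseteq> affine hull (Q v)"
    using Q_hull[OF \<sigma>] convex_hull_subset_affine_hull unfolding a_def b_def d_def by blast
  \<comment> \<open>This is the affine function \<open>L\<close> of the vertex \<open>v\<close>. It
    vanishes at \<open>a\<close>, \<open>b\<close>, \<open>d\<close>, which span the plane, hence
    also at \<open>q v r\<close>, where its value is the coefficient.\<close>
  define f where "f y = (\<Sum>k=1..3. bary (Q v) y (q v k) * cv v k)" for y
  have f0: "f p = 0" if "p \<in> {a, b, d}" for p
    using that z by (auto simp: f_def b_vv_def a_def b_def d_def)
  have "f (q v r) = (\<Sum>k=1..3. \<Sum>p\<in>{a, b, d}. w p * (bary (Q v) p (q v k) * cv v k))"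
    unfolding f_def bary_combine[OF i(4) fin sub w] by (simp only: sum_distrib_right mult.assoc)
  also have "\<dots> = (\<Sum>p\<in>{a, b, d}. w p * f p)"
    unfolding f_def sum_distrib_left by (rule sum.swap)
  also have "\<dots> = 0" using f0 by (intro sum.neutral) auto
  finally have f: "f (q v r) = 0" .
  have r3: "r = 1 \<or> r = 2 \<or> r = 3" using r by auto
  then have qQ: "q v r \<in> Q v" by (auto simp: Q_def)
  have finQ: "finite (Q v)" by (simp add: Q_def)
  have "bary (Q v) (q v r) = (\<lambda>p. if p = q v r then 1 else 0)"
  proof (rule bary_eqI[OF i(4)])
    have "(if p = q v r then 1 else 0) *\<^sub>R p = (if p = q v r then q v r else 0)" for p by simp
    then show "(\<Sum>p\<in>Q v. (if p = q v r then 1 else 0) *\<^sub>R p) = q v r" using finQ qQ by simp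
  qed (use finQ qQ in auto)
  then have "f (q v r) = cv v r" using r3 i(1-3) unfolding f_def sum_three by auto
  with f show ?thesis by simp
qed

section \<open>The reduced functions\<close>

text \<open>Exactly at these edges the second reduction mixes the functions of the two
  sides.\<close>

definition has_sym :: "point set \<Rightarrow> bool" where
  "has_sym e \<longleftrightarrow> (\<exists>t\<in>attached e. t \<in> T_sym)"

text \<open>A symmetric triangle has one coefficient for all its three edges, indexed by \<open>({}, \<tau>)\<close>; \<open>spread d\<close>
  lists the coefficients of the functions \<open>B1\<close> in the combination of the functions \<open>B2\<close> with
  coefficients \<open>d\<close>.\<close>

definition owner :: "point set \<Rightarrow> point set \<Rightarrow> point set \<times> point set" where
  "owner e \<tau> = (if \<tau> \<in> T_sym then ({}, \<tau>) else (e, \<tau>))"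

definition spread :: "(point set \<times> point set \<Rightarrow> real) \<Rightarrow> point set \<Rightarrow> point set \<Rightarrow> real" where
  "spread d e \<tau> = (if has_sym e then 2/3 * d (owner e \<tau>) + 1/3 * d (owner e (other e \<tau>)) else d (owner e \<tau>))"

section \<open>Symmetric triangles and their edges\<close>

lemma T_symD: "t \<in> T_sym \<Longrightarrow> t \<in> T" "t \<in> T_sym \<Longrightarrow> sym_triangle t"
  by (auto simp: T_sym_def)

lemma empty_notin_T_sym: "{} \<notin> T_sym"
  using card_T[of "{}"] T_symD(1)[of "{}"] by auto

text \<open>Neighbours are defined by the size of the intersection: it contains \<open>e\<close>,
  and three common points would make the triangles equal.\<close>

lemma attached_neighbours:
  assumes t: "t \<in> T" "e \<in> edges_of t"
  shows "attached e \<subseteq> insert t (neighbours t)"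
proof
  fix t' assume t': "t' \<in> attached e"
  show "t' \<in> insert t (neighbours t)"
  proof (cases "t' = t")
    case False
    have T: "t' \<in> T" "e \<subseteq> t \<inter> t'" using t' t by (auto simp: attached_def edges_of_def)
    have fin: "finite (t \<inter> t')" using finite_triangle t(1) by auto
    have "2 \<le> card (t \<inter> t')" using card_mono[OF fin T(2)] edges_ofD(2)[OF t] by simp
    moreover have "card (t \<inter> t') < 3"
    proof -
      have "t \<inter> t' \<subset> t"
        using False card_subset_eq[OF finite_triangle[OF T(1)], of t] card_T t(1) T(1) by auto
      then show ?thesis using psubset_card_mono[OF finite_triangle[OF t(1)]] card_T[OF t(1)] by metis
    qed
    ultimately show ?thesis using T(1) by (simp add: neighbours_def)
  qed simp
qed

text \<open>An edge omits exactly one vertex of \<open>t\<close>, and the prescribed list of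
  neighbours has a member through the other two.\<close>

lemma sym_edge_interior:
  assumes t: "t \<in> T_sym" and e: "e \<in> edges_of t"
  shows "\<not> boundary_edge e"
proof -
  obtain v1 v2 v3 where v: "t = {v1, v2, v3}"
    "neighbours t = {{v1, v2, v1 + v2 - v3}, {v2, v3, v2 + v3 - v1}, {v3, v1, v3 + v1 - v2}}"
    using T_symD(2)[OF t] unfolding sym_triangle_def by blast
  have T: "t \<in> T" using t by (rule T_symD)
  obtain r where r: "t = insert r e" "r \<notin> e" using opposite_vertex[OF T e] .
  then have sub: "e \<subseteq> {v1, v2, v3} - {r}" and "r \<in> {v1, v2, v3}" using v(1) by auto
  then consider "r = v1" | "r = v2" | "r = v3" by blast
  then have "e \<subseteq> {v1, v2, v1 + v2 - v3} \<or> e \<subseteq> {v2, v3, v2 + v3 - v1} \<or> e \<subseteq> {v3, v1, v3 + v1 - v2}"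
    using sub by cases auto
  then have "\<exists>t'\<in>neighbours t. e \<subseteq> t'" unfolding v(2) by blast
  then obtain t' where t': "t' \<in> neighbours t" "e \<subseteq> t'" by blast
  then have "t' \<in> attached e" "t' \<noteq> t"
    using card_T[OF T] by (auto simp: neighbours_def attached_def)
  moreover have "t \<in> attached e" using edges_ofD[OF T e] by blast
  ultimately have "card (attached e) \<noteq> 1" by (metis card_1_singletonE singletonD)
  then show ?thesis by (simp add: boundary_edge_def)
qed

lemma has_sym_interior: "e \<in> E \<Longrightarrow> has_sym e \<Longrightarrow> \<not> boundary_edge e"
  using sym_edge_interior attached_iff by (auto simp: has_sym_def)

lemma other_attached:
  assumes "(e, \<tau>) \<in> \<Xi>1" "\<not> boundary_edge e"
  shows "\<tau> \<in> attached e" "other e \<tau> \<in> attached e" "other e \<tau> \<noteq> \<tau>" "other e (other e \<tau>) = \<tau>"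
    "attached e = {\<tau>, other e \<tau>}" "(e, other e \<tau>) \<in> \<Xi>1"
proof -
  have e: "e \<in> E" and \<tau>: "\<tau> \<in> attached e" using assms by (auto simp: \<Xi>1_iff)
  obtain t' where "attached e = {\<tau>, t'}" "\<tau> \<noteq> t'" "other e \<tau> = t'" "other e t' = \<tau>"
    using attached_interior_edge[OF e assms(2) \<tau>] .
  then show "\<tau> \<in> attached e" "other e \<tau> \<in> attached e" "other e \<tau> \<noteq> \<tau>" "other e (other e \<tau>) = \<tau>"
    "attached e = {\<tau>, other e \<tau>}" "(e, other e \<tau>) \<in> \<Xi>1"
    using e by (auto simp: \<Xi>1_iff)
qed

section \<open>The reduced functions as splines\<close>

lemma empty_notin_E: "{} \<notin> E"
  using edgeD(1)[of "{}"] by auto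

lemma owner_in_\<Xi>2: "(e, \<tau>) \<in> \<Xi>1 \<Longrightarrow> owner e \<tau> \<in> \<Xi>2"
  by (auto simp: owner_def \<Xi>2_def)

lemma \<Xi>2_cases:
  assumes "\<eta> \<in> \<Xi>2"
  obtains t where "\<eta> = ({}, t)" "t \<in> T_sym"
  | e \<tau> where "\<eta> = (e, \<tau>)" "(e, \<tau>) \<in> \<Xi>1" "\<tau> \<notin> T_sym" "e \<noteq> {}"
  using assms empty_notin_E by (auto simp: \<Xi>2_def \<Xi>1_iff)

text \<open>The coefficients on the right ignore the vertex. They equal the sum of the two unit
  vectors only at triplets with the vertex on the edge, which is all that \<open>spline_cong\<close>
  compares.\<close>

lemma B1_eq_spline:
  assumes "(e, \<tau>) \<in> \<Xi>1"
  shows "B1 e \<tau> x = spline (\<lambda>_ _. 0) (\<lambda>(v, e', \<tau>'). if e' = e \<and> \<tau>' = \<tau> then 1 else 0) x"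
proof -
  have e: "e \<in> E" using assms by (simp add: \<Xi>1_iff)
  have "B1 e \<tau> x = (\<Sum>v\<in>e. 1 * spline (\<lambda>_ _. 0) (\<lambda>\<xi>. if \<xi> = (v, e, \<tau>) then 1 else 0) x)"
    by (simp add: B1_def B0_def)
  also have "\<dots> = spline (\<lambda>_ _. \<Sum>v\<in>e. 1 * 0) (\<lambda>\<xi>. \<Sum>v\<in>e. 1 * (if \<xi> = (v, e, \<tau>) then 1 else 0)) x"
    by (rule spline_sum)
  also have "\<dots> = spline (\<lambda>_ _. 0) (\<lambda>(v, e', \<tau>'). if e' = e \<and> \<tau>' = \<tau> then 1 else 0) x"
  proof (rule spline_cong)
    fix v :: point and e' \<tau>' :: "point set" assume v: "v \<in> e'"
    have "(if (v, e', \<tau>') = (w, e, \<tau>) then 1 else 0 :: real) =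
      (if w = v then (if e' = e \<and> \<tau>' = \<tau> then 1 else 0) else 0)" for w by simp
    then show "(\<Sum>w\<in>e. 1 * (if (v, e', \<tau>') = (w, e, \<tau>) then 1 else 0 :: real)) =
      (case (v, e', \<tau>') of (v, e', \<tau>') \<Rightarrow> if e' = e \<and> \<tau>' = \<tau> then 1 else 0)"
      using v edgeD(2)[OF e] by auto
  qed simp
  finally show ?thesis .
qed

lemma B1_pair_eq_spline:
  assumes "(e, \<tau>) \<in> \<Xi>1" "\<not> boundary_edge e"
  shows "2/3 * B1 e \<tau> x + 1/3 * B1 e (other e \<tau>) x =
    spline (\<lambda>_ _. 0) (\<lambda>(v, e', \<tau>'). if e' = e then 2/3 * (if \<tau>' = \<tau> then 1 else 0)
      + 1/3 * (if \<tau>' = other e \<tau> then 1 else 0) else 0) x" (is "_ = spline _ ?c x")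
proof -
  let ?f = "\<lambda>\<tau>. \<lambda>(v :: point, e', \<tau>'). if e' = e \<and> \<tau>' = \<tau> then 1 else 0 :: real"
  have "2/3 * B1 e \<tau> x + 1/3 * B1 e (other e \<tau>) x
    = (\<Sum>i\<in>{\<tau>, other e \<tau>}. (if i = \<tau> then 2/3 else 1/3) * spline (\<lambda>_ _. 0) (?f i) x)"
    using other_attached(3)[OF assms] B1_eq_spline[OF assms(1)] B1_eq_spline[OF other_attached(6)[OF assms]]
    by simp
  also have "\<dots> = spline (\<lambda>_ _. \<Sum>i\<in>{\<tau>, other e \<tau>}. (if i = \<tau> then 2/3 else 1/3) * 0)
    (\<lambda>\<xi>. \<Sum>i\<in>{\<tau>, other e \<tau>}. (if i = \<tau> then 2/3 else 1/3) * ?f i \<xi>) x"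
    by (rule spline_sum)
  also have "\<dots> = spline (\<lambda>_ _. 0) ?c x"
    by (rule spline_cong) (use other_attached(3)[OF assms] in auto)
  finally show ?thesis .
qed

lemma owner_eq_sym:
  assumes "t \<in> T_sym" "e \<in> E" shows "owner e \<tau> = ({}, t) \<longleftrightarrow> \<tau> = t"
  using assms empty_notin_E by (auto simp: owner_def)

lemma owner_eq_edge:
  assumes "\<tau>0 \<notin> T_sym" "e0 \<noteq> {}" shows "owner e \<tau> = (e0, \<tau>0) \<longleftrightarrow> e = e0 \<and> \<tau> = \<tau>0"
  using assms by (auto simp: owner_def)

text \<open>\<open>B2\<close> lists the functions \<open>B1\<close> used by an index,
  \<open>spread\<close> the indices using a given \<open>B1\<close>: columns and rows of the same
  matrix. They match because \<open>other e\<close> is an involution.\<close>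

lemma B2_eq_spline:
  assumes "\<eta> \<in> \<Xi>2"
  shows "B2 \<eta> x = spline (\<lambda>_ _. 0) (\<lambda>(v, e, \<tau>). spread (\<lambda>\<eta>'. if \<eta>' = \<eta> then 1 else 0) e \<tau>) x"
  using assms
proof (cases rule: \<Xi>2_cases)
  case (1 t)
  have t: "t \<in> T" using 1(2) by (rule T_symD)
  have \<Xi>: "(e, t) \<in> \<Xi>1" "\<not> boundary_edge e" if "e \<in> edges_of t" for e
    using sym_edge_interior[OF 1(2) that] edges_ofD[OF t that] by (auto simp: \<Xi>1_iff)
  have fin: "finite (edges_of t)" using finite_triangle[OF t] by (simp add: edges_of_def)
  let ?c = "\<lambda>e. \<lambda>(v :: point, e', \<tau>'). if e' = e then 2/3 * (if \<tau>' = t then 1 else 0)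
      + 1/3 * (if \<tau>' = other e t then 1 else 0) else 0 :: real"
  have "B2 \<eta> x = (\<Sum>e\<in>edges_of t. 1 * spline (\<lambda>_ _. 0) (?c e) x)"
    unfolding 1(1) using B1_pair_eq_spline[OF \<Xi>] by simp
  also have "\<dots> = spline (\<lambda>_ _. \<Sum>e\<in>edges_of t. 1 * 0) (\<lambda>\<xi>. \<Sum>e\<in>edges_of t. 1 * ?c e \<xi>) x"
    by (rule spline_sum)
  also have "\<dots> = spline (\<lambda>_ _. 0) (\<lambda>(v, e, \<tau>). spread (\<lambda>\<eta>'. if \<eta>' = \<eta> then 1 else 0) e \<tau>) x"
  proof (rule spline_cong)
    fix v :: point and e \<tau> :: "point set" assume e: "v \<in> e" "(e, \<tau>) \<in> \<Xi>1"
    then have eE: "e \<in> E" by (simp add: \<Xi>1_iff)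
    have "(\<Sum>e'\<in>edges_of t. 1 * ?c e' (v, e, \<tau>)) = (\<Sum>e'\<in>edges_of t. if e' = e then ?c e (v, e, \<tau>) else 0)"
      by (rule sum.cong) auto
    also have "\<dots> = (if e \<in> edges_of t then ?c e (v, e, \<tau>) else 0)" using fin by simp
    also have "\<dots> = spread (\<lambda>\<eta>'. if \<eta>' = \<eta> then 1 else 0) e \<tau>"
    proof (cases "e \<in> edges_of t")
      case True
      then have hs: "has_sym e" using 1(2) edges_ofD[OF t True] by (auto simp: has_sym_def)
      have "other e \<tau> = t \<longleftrightarrow> \<tau> = other e t"
        using other_attached(4)[OF e(2)] other_attached(4)[OF \<Xi>(1)[OF True]] \<Xi>(2)[OF True] by metis
      then show ?thesis using True hs by (simp add: spread_def 1(1) owner_eq_sym[OF 1(2) eE])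
    next
      case False
      \<comment> \<open>Off the edges of \<open>t\<close> neither owner may be
        \<open>({}, t)\<close>. The second owner matters only under \<open>has_sym e\<close>, and
        there the edge is interior and \<open>other\<close> meaningful.\<close>
      then have na: "t \<notin> attached e" using attached_iff[OF eE] by auto
      have "\<tau> \<noteq> t" using na e(2) empty_notin_T_sym 1(2) by (auto simp: \<Xi>1_iff)
      moreover have "other e \<tau> \<noteq> t" if "has_sym e"
        using other_attached(2)[OF e(2) has_sym_interior[OF eE that]] na by auto
      ultimately show ?thesis using False by (simp add: spread_def 1(1) owner_eq_sym[OF 1(2) eE])
    qed
    finally show "(\<Sum>e'\<in>edges_of t. 1 * ?c e' (v, e, \<tau>)) =
      (case (v, e, \<tau>) of (v, e, \<tau>) \<Rightarrow> spread (\<lambda>\<eta>'. if \<eta>' = \<eta> then 1 else 0) e \<tau>)" by simp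
  qed simp
  finally show ?thesis .
next
  case (2 e0 \<tau>0)
  have eE: "e0 \<in> E" using 2(2) by (simp add: \<Xi>1_iff)
  \<comment> \<open>The index triangle is not symmetric, so any symmetric triangle at the edge is
    automatically the other one.\<close>
  have hs: "(\<exists>t\<in>T_sym. t \<in> attached e0 \<and> t \<noteq> \<tau>0) \<longleftrightarrow> has_sym e0"
    using 2(3) by (auto simp: has_sym_def)
  show ?thesis
  proof (cases "has_sym e0")
    case True
    note ni = has_sym_interior[OF eE True]
    have "B2 \<eta> x = 2/3 * B1 e0 \<tau>0 x + 1/3 * B1 e0 (other e0 \<tau>0) x"
      using True hs 2(1,4) by simp
    also have "\<dots> = spline (\<lambda>_ _. 0) (\<lambda>(v, e, \<tau>). spread (\<lambda>\<eta>'. if \<eta>' = \<eta> then 1 else 0) e \<tau>) x"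
      unfolding B1_pair_eq_spline[OF 2(2) ni]
    proof (rule spline_cong)
      fix v :: point and e \<tau> :: "point set" assume e: "v \<in> e" "(e, \<tau>) \<in> \<Xi>1"
      have "other e0 \<tau> = \<tau>0 \<longleftrightarrow> \<tau> = other e0 \<tau>0" if "e = e0"
        using other_attached(4)[OF e(2)] other_attached(4)[OF 2(2)] ni that by metis
      then show "(case (v, e, \<tau>) of (v, e', \<tau>') \<Rightarrow> if e' = e0 then 2/3 * (if \<tau>' = \<tau>0 then 1 else 0)
          + 1/3 * (if \<tau>' = other e0 \<tau>0 then 1 else 0) else 0) =
        (case (v, e, \<tau>) of (v, e, \<tau>) \<Rightarrow> spread (\<lambda>\<eta>'. if \<eta>' = \<eta> then 1 else 0 :: real) e \<tau>)"
        using True by (simp add: spread_def 2(1) owner_eq_edge[OF 2(3,4)])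
    qed simp
    finally show ?thesis .
  next
    case False
    then have n: "\<not> (\<exists>t\<in>T_sym. t \<in> attached e0 \<and> t \<noteq> \<tau>0)" using hs by blast
    have "B2 \<eta> x = B1 e0 \<tau>0 x" by (simp only: 2(1) B2.simps if_not_P[OF 2(4)] if_not_P[OF n])
    also have "\<dots> = spline (\<lambda>_ _. 0) (\<lambda>(v, e, \<tau>). spread (\<lambda>\<eta>'. if \<eta>' = \<eta> then 1 else 0) e \<tau>) x"
      unfolding B1_eq_spline[OF 2(2)]
      by (rule spline_cong) (use False in \<open>auto simp: spread_def 2(1) owner_eq_edge[OF 2(3,4)]\<close>)
    finally show ?thesis .
  qed
qed

lemma finite_E: "finite E"
  using finite_T finite_triangle by (auto simp: E_def edges_of_def)

lemma finite_\<Xi>2: "finite \<Xi>2"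
proof (rule finite_subset)
  show "\<Xi>2 \<subseteq> insert {} E \<times> insert {} T"
    using T_symD by (auto simp: \<Xi>2_def \<Xi>1_iff attached_def)
qed (use finite_E finite_T in auto)

lemma finite_vertex_idx: "finite vertex_idx"
  using finite_T finite_triangle by (auto simp: vertex_idx_def V_def)

lemma finite_all_idx: "finite all_idx"
  using finite_vertex_idx finite_\<Xi>2 by (simp add: all_idx_def)

lemma spread_expand:
  assumes "(e, \<tau>) \<in> \<Xi>1"
  shows "(\<Sum>\<eta>\<in>\<Xi>2. d \<eta> * spread (\<lambda>\<eta>'. if \<eta>' = \<eta> then 1 else 0) e \<tau>) = spread d e \<tau>"
proof -
  have pick: "(\<Sum>\<eta>\<in>\<Xi>2. d \<eta> * (a * (if \<eta>0 = \<eta> then 1 else 0))) = a * d \<eta>0" if "\<eta>0 \<in> \<Xi>2" for \<eta>0 a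
  proof -
    have "d \<eta> * (a * (if \<eta>0 = \<eta> then 1 else 0)) = (if \<eta>0 = \<eta> then a * d \<eta>0 else 0)" for \<eta> by simp
    then show ?thesis using finite_\<Xi>2 that by simp
  qed
  have 1: "owner e \<tau> \<in> \<Xi>2" using owner_in_\<Xi>2[OF assms] .
  show ?thesis
  proof (cases "has_sym e")
    case True
    have "e \<in> E" using assms by (simp add: \<Xi>1_iff)
    then have "(e, other e \<tau>) \<in> \<Xi>1" using other_attached(6)[OF assms] has_sym_interior True by blast
    then have 2: "owner e (other e \<tau>) \<in> \<Xi>2" by (rule owner_in_\<Xi>2)
    show ?thesis using True pick[OF 1, of "2/3"] pick[OF 2, of "1/3"]
      by (simp add: spread_def distrib_left sum.distrib del: times_divide_eq_left times_divide_eq_right)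
  next
    case False
    then show ?thesis using pick[OF 1, of 1] by (simp add: spread_def)
  qed
qed

text \<open>The bridge from functions to coefficients: both the sum of all functions and their
  linear independence are read off from it.\<close>

lemma combination_eq_spline:
  "(\<Sum>i\<in>all_idx. d i * B i x) =
    spline (\<lambda>v r. d (Inl (v, r))) (\<lambda>(v, e, \<tau>). spread (\<lambda>\<eta>. d (Inr \<eta>)) e \<tau>) x"
proof -
  let ?cv = "\<lambda>v r. \<Sum>i\<in>vertex_idx. d (Inl i) * (if (v, r) = i then 1 else 0)"
  let ?c = "\<lambda>\<xi>. \<Sum>\<eta>\<in>\<Xi>2. d (Inr \<eta>) * (\<lambda>(v, e, \<tau>). spread (\<lambda>\<eta>'. if \<eta>' = \<eta> then 1 else 0) e \<tau>) \<xi>"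
  have "(\<Sum>i\<in>all_idx. d i * B i x) =
    (\<Sum>i\<in>vertex_idx. d (Inl i) * vertex_fun i x) + (\<Sum>\<eta>\<in>\<Xi>2. d (Inr \<eta>) * B2 \<eta> x)"
    unfolding all_idx_def by (subst sum.Plus) (use finite_vertex_idx finite_\<Xi>2 in \<open>auto simp: B_def\<close>)
  also have "(\<Sum>i\<in>vertex_idx. d (Inl i) * vertex_fun i x) =
      spline ?cv (\<lambda>\<xi>. \<Sum>i\<in>vertex_idx. d (Inl i) * 0) x"
    unfolding vertex_fun_def by (rule spline_sum)
  also have "(\<Sum>\<eta>\<in>\<Xi>2. d (Inr \<eta>) * B2 \<eta> x) = spline (\<lambda>_ _. \<Sum>\<eta>\<in>\<Xi>2. d (Inr \<eta>) * 0) ?c x"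
    unfolding spline_sum[symmetric] by (rule sum.cong) (auto simp: B2_eq_spline)
  also have "spline ?cv (\<lambda>\<xi>. \<Sum>i\<in>vertex_idx. d (Inl i) * 0) x + spline (\<lambda>_ _. \<Sum>\<eta>\<in>\<Xi>2. d (Inr \<eta>) * 0) ?c x
    = spline ?cv ?c x"
    using spline_linear[of 1 ?cv "\<lambda>_ _. 0" "\<lambda>_. 0" ?c x] by simp
  also have "\<dots> = spline (\<lambda>v r. d (Inl (v, r))) (\<lambda>(v, e, \<tau>). spread (\<lambda>\<eta>. d (Inr \<eta>)) e \<tau>) x"
  proof (rule spline_cong)
    fix v r assume "v \<in> V" "r \<in> {1..3::nat}"
    then have "(v, r) \<in> vertex_idx" by (simp add: vertex_idx_def)
    moreover have "?cv v r = (\<Sum>i\<in>vertex_idx. if (v, r) = i then d (Inl (v, r)) else 0)"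
      by (rule sum.cong) auto
    ultimately show "?cv v r = d (Inl (v, r))" using finite_vertex_idx by simp
  next
    fix v e \<tau> assume "(e, \<tau>) \<in> \<Xi>1"
    then show "?c (v, e, \<tau>) = (case (v, e, \<tau>) of (v, e, \<tau>) \<Rightarrow> spread (\<lambda>\<eta>. d (Inr \<eta>)) e \<tau>)"
      using spread_expand[of e \<tau> "\<lambda>\<eta>. d (Inr \<eta>)"] by simp
  qed
  finally show ?thesis .
qed

section \<open>Partition of unity and linear independence\<close>

lemma sum_B:
  assumes "x \<in> (\<Union>t\<in>T. convex hull t)"
  shows "(\<Sum>i\<in>all_idx. B i x) = 1"
proof -
  obtain t where t: "t \<in> T" "x \<in> convex hull t" using assms by blast
  obtain v e u1 u2 u3 where \<sigma>: "(v, e, t) \<in> small" "0 \<le> u1" "0 \<le> u2" "0 \<le> u3" "u1 + u2 + u3 = 1"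
    "x = u1 *\<^sub>R v + u2 *\<^sub>R ve e + u3 *\<^sub>R vt t" using small_cover[OF t] .
  have "(\<Sum>i\<in>all_idx. B i x) = spline (\<lambda>_ _. 1) (\<lambda>(v, e, \<tau>). spread (\<lambda>\<eta>. 1) e \<tau>) x"
    using combination_eq_spline[of "\<lambda>_. 1" x] by simp
  also have "(\<lambda>(v :: point, e, \<tau>). spread (\<lambda>\<eta>. 1) e \<tau>) = (\<lambda>_. 1)"
    by (auto simp: spread_def)
  also have "spline (\<lambda>_ _. 1) (\<lambda>_. 1) x = 1"
    unfolding \<sigma>(6) spline_eq_poly[OF \<sigma>(1-5)] by (rule bb_poly_const[OF \<sigma>(1,5)])
  finally show ?thesis .
qed

lemma B_nonneg:
  assumes "i \<in> all_idx" shows "0 \<le> B i x"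
proof (cases i)
  case (Inl p)
  then show ?thesis by (auto simp: B_def vertex_fun_def intro!: spline_nonneg)
next
  case (Inr \<eta>)
  then have "\<eta> \<in> \<Xi>2" using assms by (auto simp: all_idx_def)
  then show ?thesis using Inr
    by (auto simp: B_def B2_eq_spline spread_def intro!: spline_nonneg)
qed

text \<open>The equations for the two sides of the edge involve the same two unknowns in exchanged
  roles, with the matrix of determinant 1/3.\<close>

lemma spread_zero:
  assumes z: "\<And>e \<tau>. (e, \<tau>) \<in> \<Xi>1 \<Longrightarrow> spread d e \<tau> = 0" and e: "(e, \<tau>) \<in> \<Xi>1"
  shows "d (owner e \<tau>) = 0"
proof (cases "has_sym e")
  case True
  have "e \<in> E" using e by (simp add: \<Xi>1_iff)
  then have nb: "\<not> boundary_edge e" using has_sym_interior True by blast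
  have "2/3 * d (owner e \<tau>) + 1/3 * d (owner e (other e \<tau>)) = 0"
    using z[OF e] True by (simp add: spread_def)
  moreover have "2/3 * d (owner e (other e \<tau>)) + 1/3 * d (owner e \<tau>) = 0"
    using z[OF other_attached(6)[OF e nb]] True other_attached(4)[OF e nb] by (simp add: spread_def)
  ultimately show ?thesis by linarith
next
  case False
  then show ?thesis using z[OF e] by (simp add: spread_def)
qed

lemma combination_zero:
  assumes z: "\<And>x. (\<Sum>i\<in>all_idx. d i * B i x) = 0" and i: "i \<in> all_idx"
  shows "d i = 0"
proof -
  let ?cv = "\<lambda>v r. d (Inl (v, r))"
  let ?c = "\<lambda>(v :: point, e, \<tau>). spread (\<lambda>\<eta>. d (Inr \<eta>)) e \<tau>"
  have "spline ?cv ?c x = 0" for x using z combination_eq_spline[of d x] by simp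
  note ord = spline_zero_ordinates[of ?cv ?c, OF this]
  have vertex: "d (Inl (v, r)) = 0" if v: "v \<in> V" and r: "r \<in> {1..3}" for v r
  proof -
    obtain t where t: "t \<in> T" "v \<in> t" using v by (auto simp: V_def)
    have "card (t - {v}) = 2" using card_T[OF t(1)] t(2) finite_triangle[OF t(1)] by simp
    then obtain w where "w \<in> t - {v}" by (metis card.empty ex_in_conv zero_neq_numeral)
    then have \<sigma>: "(v, {v, w}, t) \<in> small" using pair_edge[OF t] t(1) by (auto simp: small_def)
    show ?thesis by (rule b_vv_zero_coefficients[OF \<sigma> ord(1-3)[OF \<sigma>] r])
  qed
  have b_vv0: "b_vv ?cv v w = 0" if "v \<in> V" for v w
    unfolding b_vv_def using vertex[OF that] by (intro sum.neutral) simp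
  \<comment> \<open>The vertex coefficients are already 0, so \<open>b_vet\<close>, or
    \<open>b_vee\<close> at a boundary edge, is just \<open>1 - lam v e\<close> times the
    coefficient sought.\<close>
  have edge: "spread (\<lambda>\<eta>. d (Inr \<eta>)) e \<tau> = 0" if e: "(e, \<tau>) \<in> \<Xi>1" for e \<tau>
  proof -
    have eE: "e \<in> E" using e by (simp add: \<Xi>1_iff)
    obtain t where t: "t \<in> attached e" using E_attached[OF eE] by blast
    \<comment> \<open>Either endpoint will do, because after the first reduction both carry the same
      coefficient.\<close>
    obtain v where v: "v \<in> e" using edgeD(1)[OF eE] by fastforce
    have \<sigma>: "(v, e, t') \<in> small" if "t' \<in> attached e" for t'
      using that v attached_iff[OF eE] by (simp add: small_def)
    have vV: "v \<in> V" using smallD[OF \<sigma>[OF t]] by (auto simp: V_def)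
    note l = lam_less_1[OF eE v]
    show ?thesis
    proof (cases "\<tau> \<in> attached e")
      case True
      then show ?thesis using ord(5)[OF \<sigma>[OF True]] l by (simp add: b_vet_def b_vv0[OF vV])
    next
      case False
      then have "\<tau> = {}" "boundary_edge e" using e by (auto simp: \<Xi>1_iff)
      then show ?thesis using ord(4)[OF \<sigma>[OF t]] l by (simp add: b_vee_def b_vv0[OF vV])
    qed
  qed
  note owner0 = spread_zero[of "\<lambda>\<eta>. d (Inr \<eta>)", OF edge]
  show ?thesis
  proof (cases i)
    case (Inl p)
    then show ?thesis using i vertex by (cases p) (auto simp: all_idx_def vertex_idx_def)
  next
    case (Inr \<eta>)
    then have "\<eta> \<in> \<Xi>2" using i by (auto simp: all_idx_def)
    then show ?thesis
    proof (cases rule: \<Xi>2_cases)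
      case (1 t)
      have t: "t \<in> T" using 1(2) by (rule T_symD)
      \<comment> \<open>Any edge of the symmetric triangle reveals its coefficient, since all three
        share the owner \<open>({}, t)\<close>.\<close>
      obtain p r s where "t = {p, r, s}" "p \<noteq> r" using card_T[OF t] by (auto simp: card_3_iff)
      then have "{p, r} \<in> edges_of t" by (auto simp: edges_of_def)
      from edges_ofD(5,6)[OF t this] have "({p, r}, t) \<in> \<Xi>1" by (simp add: \<Xi>1_iff)
      from owner0[OF _ this] 1 Inr show ?thesis by (simp add: owner_def)
    next
      case (2 e \<tau>)
      from owner0[OF _ 2(2)] 2 Inr show ?thesis by (simp add: owner_def)
    qed
  qed
qed

lemma basis_of_S2: "basis_of S2 all_idx B"
proof -
  have "B ` all_idx = vertex_fun ` vertex_idx \<union> B2 ` \<Xi>2"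
    by (simp add: all_idx_def Plus_def image_Un image_image B_def)
  moreover have "\<forall>d. (\<forall>x. (\<Sum>i\<in>all_idx. d i * B i x) = 0) \<longrightarrow> (\<forall>i\<in>all_idx. d i = 0)"
    using combination_zero by blast
  ultimately show ?thesis
    using finite_family_independent[OF finite_all_idx, of B] by (simp add: basis_of_def S2_def)
qed

section \<open>Local support\<close>

lemma spline_vanishes:
  assumes "t \<in> T" "x \<in> convex hull t"
    and "\<And>v r. v \<in> t \<Longrightarrow> r \<in> {1..3} \<Longrightarrow> cv v r = 0"
    and "\<And>v e \<tau>. v \<in> e \<Longrightarrow> e \<in> edges_of t \<Longrightarrow> (e, \<tau>) \<in> \<Xi>1 \<Longrightarrow> c (v, e, \<tau>) = 0"
  shows "spline cv c x = 0"
  using spline_cong_on[OF assms(1,2), of cv "\<lambda>_ _. 0" c "\<lambda>_. 0"] assms(3,4) by (simp add: spline_zero)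

lemma B1_support:
  assumes "(e, \<tau>) \<in> \<Xi>1" "t \<in> T" "x \<in> convex hull t" "t \<notin> attached e"
  shows "B1 e \<tau> x = 0"
  unfolding B1_eq_spline[OF assms(1)]
  by (rule spline_vanishes[OF assms(2,3)]) (use assms(2,4) in \<open>auto simp: attached_def edges_of_def\<close>)

text \<open>For a symmetric triangle \<open>s\<close>, every triangle attached to one of its edges
  is \<open>s\<close> or a neighbour, so \<open>t\<close> is attached to none of them and each
  summand vanishes on \<open>t\<close>. At a mixed edge both functions \<open>B1\<close> belong to
  the same edge, so mixing does not enlarge the support.\<close>

lemma B_support:
  assumes i: "i \<in> all_idx" and t: "t \<in> T" "x \<in> convex hull t" "t \<notin> support_triangles i"
  shows "B i x = 0"
proof (cases i)
  case (Inl p)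
  obtain v r where p: "p = (v, r)" by (cases p)
  have "v \<notin> t" using t(1,3) Inl p by simp
  then show ?thesis unfolding Inl p B_def vertex_fun_def
    by (simp, intro spline_vanishes[OF t(1,2)]) auto
next
  case (Inr \<eta>)
  then have "\<eta> \<in> \<Xi>2" using i by (auto simp: all_idx_def)
  then show ?thesis
  proof (cases rule: \<Xi>2_cases)
    case (1 s)
    have s: "s \<in> T" using 1(2) by (rule T_symD)
    have ns: "t \<notin> insert s (neighbours s)" using t(3) Inr 1 by simp
    have "B1 e s x = 0 \<and> B1 e (other e s) x = 0" if e: "e \<in> edges_of s" for e
    proof -
      have \<Xi>: "(e, s) \<in> \<Xi>1" using edges_ofD[OF s e] by (auto simp: \<Xi>1_iff)
      have na: "t \<notin> attached e" using attached_neighbours[OF s e] ns by blast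
      show ?thesis
        using B1_support[OF \<Xi> t(1,2) na] B1_support[OF other_attached(6) t(1,2) na]
          \<Xi> sym_edge_interior[OF 1(2) e] by blast
    qed
    then show ?thesis using Inr 1 by (simp add: B_def)
  next
    case (2 e \<tau>)
    have na: "t \<notin> attached e" using t(3) Inr 2 by simp
    have e: "e \<in> E" using 2(2) by (simp add: \<Xi>1_iff)
    have "B1 e (other e \<tau>) x = 0" if "\<exists>t\<in>T_sym. t \<in> attached e \<and> t \<noteq> \<tau>"
    proof -
      have "\<not> boundary_edge e" using that has_sym_interior[OF e] by (auto simp: has_sym_def)
      from B1_support[OF other_attached(6)[OF 2(2) this] t(1,2) na] show ?thesis .
    qed
    then show ?thesis using Inr 2 B1_support[OF 2(2) t(1,2) na] by (simp add: B_def)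
  qed
qed

end

theorem theorem8:
  fixes \<Omega> :: "point set" and \<D> T :: "point set set" and l :: nat
    and vt ve :: "point set \<Rightarrow> point" and q :: "point \<Rightarrow> nat \<Rightarrow> point"
  assumes "polygonal_domain \<Omega>"
    and "triangulates \<D> \<Omega>"
    and "l \<ge> 1"
    and "T = refine l \<D>"
    and "powell_sabin.splits T vt ve"
    and "powell_sabin.admissible T vt ve q"
  shows "convex_partition_of_unity_on (closure \<Omega>)
           (powell_sabin.all_idx T vt) (powell_sabin.B T vt ve q)
       \<and> basis_of (powell_sabin.S2 T vt ve q)
           (powell_sabin.all_idx T vt) (powell_sabin.B T vt ve q)
       \<and> (\<forall>i\<in>powell_sabin.all_idx T vt.
           \<forall>x\<in>closure \<Omega> - (\<Union>t\<in>powell_sabin.support_triangles T i. convex hull t).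
             powell_sabin.B T vt ve q i x = 0)"
proof -
  note D = assms(2,3)
  interpret ps_mesh T vt ve q
  proof
    show "finite T" unfolding assms(4) by (rule finite_refine[OF D])
    fix t assume t: "t \<in> T"
    then show "card t = 3" unfolding assms(4) by (rule refine_cell[OF D])
    show "\<not> affine_dependent t" using t unfolding assms(4) by (rule refine_cell[OF D])
    fix t' x p
    assume "t' \<in> T" "x \<in> convex hull t" "x \<in> convex hull t'" "p \<in> t" "0 < bary t x p"
    then show "p \<in> t'" using t refine_conforming[OF D] unfolding assms(4) by blast
  qed (rule assms)+
  have cover: "closure \<Omega> = (\<Union>t\<in>T. convex hull t)"
    unfolding assms(4) by (rule refine_cover[OF D, symmetric])
  show ?thesis
  proof (intro conjI ballI)
    show "convex_partition_of_unity_on (closure \<Omega>) all_idx B"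
      unfolding convex_partition_of_unity_on_def cover
      using finite_all_idx B_nonneg sum_B by blast
    show "basis_of S2 all_idx B" by (rule basis_of_S2)
    \<comment> \<open>Some triangle of the mesh contains \<open>x\<close>; it cannot be a support
      triangle, and the function vanishes on the whole of it.\<close>
    fix i x assume i: "i \<in> all_idx" and x: "x \<in> closure \<Omega> - (\<Union>t\<in>support_triangles i. convex hull t)"
    then obtain t where "t \<in> T" "x \<in> convex hull t" "t \<notin> support_triangles i"
      unfolding cover by blast
    then show "B i x = 0" by (rule B_support[OF i])
  qed
qed

end
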